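(* Let $G$ be a second countable, non-abelian, unimodular, type I locally compact group, and let $\psi\in L^2(G)$ be a nonzero function (a window function). Then for each $f\in \mathcal{C}_c(G)$, $$\|\mathcal{G}_\psi f\|_{\mathcal{H}^2(G\times\widehat{G})}=\|f\|_{L^2(G)}\|\psi\|_{L^2(G)}.$$
   Context: $\mathcal{C}_c(G)$ is the space of continuous compactly supported complex functions on $G$; $dx$ is a fixed Haar measure on $G$. $\widehat{G}$ is the set of equivalence classes of irreducible continuous unitary representations $\pi$ of $G$, on Hilbert spaces $\mathcal{H}_\pi$, and $d\pi$ is the Plancherel measure on $\widehat{G}$ associated with $dx$, i.e. the unique measure for which $f\mapsto\widehat f$, $\widehat{f}(\pi)=\int_G f(x)\pi(x)^*dx$, maps $L^1(G)\cap L^2(G)$ into $\int^{\oplus}_{\widehat G}\mathrm{HS}(\mathcal{H}_\pi)\,d\pi$ and extends to a unitary map of $L^2(G)$ onto $\int^{\oplus}_{\widehat G}\mathrm{HS}(\mathcal{H}_\pi)\,d\pi$; here $\mathrm{HS}(\mathcal{H}_\pi)$ is the space of Hilbert–Schmidt operators on $\mathcal{H}_\pi$ with inner product $\mathrm{tr}(S^*T)$. $d\sigma$ is the product of $dx$ and $d\pi$ on $G\times\widehat G$. For $(x,\pi)\in G\times\widehat G$ let $\mathcal{H}_{(x,\pi)}=\pi(x)\mathrm{HS}(\mathcal{H}_\pi)=\{\pi(x)T:T\in \mathrm{HS}(\mathcal{H}_\pi)\}$ with inner product $\langle\pi(x)T,\pi(x)S\rangle=\mathrm{tr}(S^*T)$.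 $\mathcal{H}^2(G\times\widehat G)$ is the direct integral of the spaces $\mathcal{H}_{(x,\pi)}$ with respect to $\sigma$: measurable vector fields $F$ with $\|F\|_{\mathcal{H}^2(G\times\widehat G)}^2=\int_{G\times\widehat G}\|F(x,\pi)\|_{(x,\pi)}^2\,d\sigma(x,\pi)<\infty$, where $\|F(x,\pi)\|^2_{(x,\pi)}=\mathrm{tr}[F(x,\pi)^*F(x,\pi)]$. Continuous Gabor transform: for a window function $\psi$ (nonzero element of $L^2(G)$) and $f\in\mathcal{C}_c(G)$, $\mathcal{G}_\psi f(x,\pi)=\int_G f(y)\overline{\psi(x^{-1}y)}\pi(y)^*\,dy$, with the operator-valued integral understood weakly. *)

theory Defs
  imports "HOL-Analysis.Analysis" "HOL-Library.Extended_Nat"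
begin

text \<open>
  Groups are types of class \<open>topological_group_add\<close>.  That class does not assume commutativity; the
  group operation is merely written \<open>+\<close>, so \<open>- x + y\<close> is the product of the inverse of \<open>x\<close> with \<open>y\<close>.
\<close>

definition radon_measure :: "'g::topological_space measure \<Rightarrow> bool" where
  "radon_measure M \<longleftrightarrow>
     sets M = sets borel \<and>
     (\<forall>K. compact K \<longrightarrow> emeasure M K < \<infinity>) \<and>
     (\<forall>A\<in>sets M. emeasure M A = (INF U\<in>{U. open U \<and> A \<subseteq> U}. emeasure M U)) \<and>
     (\<forall>U. open U \<longrightarrow> emeasure M U = (SUP K\<in>{K. compact K \<and> K \<subseteq> U}. emeasure M K))"

definition haar_measure :: "'g::topological_group_add measure \<Rightarrow> bool" where
  "haar_measure M \<longleftrightarrow>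
     radon_measure M \<and> emeasure M UNIV \<noteq> 0 \<and>
     (\<forall>x. \<forall>A\<in>sets M. emeasure M ((\<lambda>a. x + a) ` A) = emeasure M A)"

definition unimodular :: "'g::topological_group_add itself \<Rightarrow> bool" where
  "unimodular _ \<longleftrightarrow>
     (\<forall>M :: 'g measure. haar_measure M \<longrightarrow>
       (\<forall>x. \<forall>A\<in>sets M. emeasure M ((\<lambda>a. a + x) ` A) = emeasure M A))"

definition Cc :: "('g::topological_space \<Rightarrow> complex) set" where
  "Cc = {f. continuous_on UNIV f \<and> compact (closure {x. f x \<noteq> 0})}"

definition L1 :: "'g measure \<Rightarrow> ('g \<Rightarrow> complex) set" where
  "L1 M = {f. integrable M f}"

definition L2 :: "'g measure \<Rightarrow> ('g \<Rightarrow> complex) set" where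
  "L2 M = {f. f \<in> borel_measurable M \<and> integrable M (\<lambda>x. (cmod (f x))\<^sup>2)}"

definition L2_inner :: "'g measure \<Rightarrow> ('g \<Rightarrow> complex) \<Rightarrow> ('g \<Rightarrow> complex) \<Rightarrow> complex" where
  "L2_inner M f g = (\<integral>x. f x * cnj (g x) \<partial>M)"

definition L2_norm :: "'g measure \<Rightarrow> ('g \<Rightarrow> complex) \<Rightarrow> real" where
  "L2_norm M f = sqrt (\<integral>x. (cmod (f x))\<^sup>2 \<partial>M)"

text \<open>
  \<open>hilb n\<close> is the standard Hilbert space of dimension \<open>n \<in> {0, 1, ..., \<infinity>}\<close>: the square-summable
  sequences supported on the indices below \<open>n\<close>.  Every separable Hilbert space is isometrically
  isomorphic to exactly one of these.
\<close>

type_synonym vec = "nat \<Rightarrow> complex"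
type_synonym oper = "vec \<Rightarrow> vec"

definition hilb :: "enat \<Rightarrow> vec set" where
  "hilb n = {v. summable (\<lambda>i. (cmod (v i))\<^sup>2) \<and> (\<forall>i. n \<le> enat i \<longrightarrow> v i = 0)}"

definition vinner :: "vec \<Rightarrow> vec \<Rightarrow> complex" where
  "vinner u v = (\<Sum>i. u i * cnj (v i))"

definition vnorm :: "vec \<Rightarrow> real" where
  "vnorm v = sqrt (\<Sum>i. (cmod (v i))\<^sup>2)"

definition vzero :: vec where
  "vzero = (\<lambda>i. 0)"

definition lincomb :: "complex \<Rightarrow> vec \<Rightarrow> complex \<Rightarrow> vec \<Rightarrow> vec" where
  "lincomb a u b v = (\<lambda>i. a * u i + b * v i)"

definition ket :: "nat \<Rightarrow> vec" where
  "ket j = (\<lambda>i. if i = j then 1 else 0)"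

text \<open>
  Bounded linear operators from \<open>hilb m\<close> to \<open>hilb n\<close>.  They are made to vanish off \<open>hilb m\<close>, so that
  equality of operators is equality of functions; in particular \<open>T (ket j) = vzero\<close> for \<open>j \<ge> m\<close>.
\<close>

definition bounded_ops :: "enat \<Rightarrow> enat \<Rightarrow> oper set" where
  "bounded_ops m n = {T.
     (\<forall>v\<in>hilb m. T v \<in> hilb n) \<and>
     (\<forall>v. v \<notin> hilb m \<longrightarrow> T v = vzero) \<and>
     (\<forall>a b. \<forall>u\<in>hilb m. \<forall>v\<in>hilb m. T (lincomb a u b v) = lincomb a (T u) b (T v)) \<and>
     (\<exists>C. \<forall>v\<in>hilb m. vnorm (T v) \<le> C * vnorm v)}"

definition isometries :: "enat \<Rightarrow> enat \<Rightarrow> oper set" where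
  "isometries m n = {T \<in> bounded_ops m n. \<forall>u\<in>hilb m. \<forall>v\<in>hilb m. vinner (T u) (T v) = vinner u v}"

definition unitaries :: "enat \<Rightarrow> enat \<Rightarrow> oper set" where
  "unitaries m n = {T \<in> isometries m n. T ` hilb m = hilb n}"

definition id_op :: "enat \<Rightarrow> oper" where
  "id_op n = (\<lambda>v. if v \<in> hilb n then v else vzero)"

text \<open>
  The adjoint, in coordinates: \<open>\<langle>T\<^sup>* v, ket i\<rangle> = \<langle>v, T (ket i)\<rangle>\<close>.  Meaningful for \<open>T\<close> in
  \<open>bounded_ops m n\<close> and on arguments in \<open>hilb n\<close>, which is the only way it is used.
\<close>

definition adj :: "oper \<Rightarrow> oper" where
  "adj T = (\<lambda>v i. vinner v (T (ket i)))"

text \<open>The sum may run over all of \<open>nat\<close>, because operators on \<open>hilb n\<close> kill \<open>ket i\<close> for \<open>i \<ge> n\<close>.\<close>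

definition tr :: "oper \<Rightarrow> complex" where
  "tr T = (\<Sum>i. vinner (T (ket i)) (ket i))"

definition HS :: "enat \<Rightarrow> oper set" where
  "HS n = {T \<in> bounded_ops n n. summable (\<lambda>i. (vnorm (T (ket i)))\<^sup>2)}"

text \<open>The inner product is \<open>tr (S\<^sup>* T)\<close>, linear in the first argument \<open>T\<close>.\<close>

definition HS_inner :: "oper \<Rightarrow> oper \<Rightarrow> complex" where
  "HS_inner T S = tr (adj S \<circ> T)"

definition has_weak_integral :: "enat \<Rightarrow> 'g measure \<Rightarrow> ('g \<Rightarrow> oper) \<Rightarrow> oper \<Rightarrow> bool" where
  "has_weak_integral n M A T \<longleftrightarrow>
     T \<in> bounded_ops n n \<and>
     (\<forall>u\<in>hilb n. \<forall>v\<in>hilb n.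
        integrable M (\<lambda>x. vinner (A x u) v) \<and> vinner (T u) v = (\<integral>x. vinner (A x u) v \<partial>M))"

definition weak_integral :: "enat \<Rightarrow> 'g measure \<Rightarrow> ('g \<Rightarrow> oper) \<Rightarrow> oper" where
  "weak_integral n M A = (THE T. has_weak_integral n M A T)"

text \<open>A representation is a pair of its dimension \<open>n\<close> and its action on \<open>hilb n\<close>.\<close>

type_synonym 'g urep = "enat \<times> ('g \<Rightarrow> oper)"

abbreviation rdim :: "'g urep \<Rightarrow> enat" where
  "rdim \<pi> \<equiv> fst \<pi>"

abbreviation act :: "'g urep \<Rightarrow> 'g \<Rightarrow> oper" where
  "act \<pi> \<equiv> snd \<pi>"

definition unitary_rep :: "'g::topological_group_add urep \<Rightarrow> bool" where
  "unitary_rep \<pi> \<longleftrightarrow>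
     (\<forall>x. act \<pi> x \<in> unitaries (rdim \<pi>) (rdim \<pi>)) \<and>
     (\<forall>x y. act \<pi> (x + y) = act \<pi> x \<circ> act \<pi> y) \<and>
     (\<forall>v\<in>hilb (rdim \<pi>). \<forall>x0.
        ((\<lambda>x. vnorm (\<lambda>i. act \<pi> x v i - act \<pi> x0 v i)) \<longlongrightarrow> 0) (at x0))"

definition closed_subspace :: "enat \<Rightarrow> vec set \<Rightarrow> bool" where
  "closed_subspace n W \<longleftrightarrow>
     W \<subseteq> hilb n \<and> vzero \<in> W \<and>
     (\<forall>a b. \<forall>u\<in>W. \<forall>v\<in>W. lincomb a u b v \<in> W) \<and>
     (\<forall>v\<in>hilb n. (\<forall>e>0. \<exists>w\<in>W. vnorm (\<lambda>i. v i - w i) < e) \<longrightarrow> v \<in> W)"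

definition irreducible_rep :: "'g::topological_group_add urep \<Rightarrow> bool" where
  "irreducible_rep \<pi> \<longleftrightarrow>
     unitary_rep \<pi> \<and> rdim \<pi> \<noteq> 0 \<and>
     (\<forall>W. closed_subspace (rdim \<pi>) W \<and> (\<forall>x. act \<pi> x ` W \<subseteq> W) \<longrightarrow> W = {vzero} \<or> W = hilb (rdim \<pi>))"

definition intertwines :: "'g urep \<Rightarrow> 'g urep \<Rightarrow> oper \<Rightarrow> bool" where
  "intertwines \<rho> \<pi> V \<longleftrightarrow>
     V \<in> bounded_ops (rdim \<rho>) (rdim \<pi>) \<and> (\<forall>x. V \<circ> act \<rho> x = act \<pi> x \<circ> V)"

text \<open>
  The irreducible representations.  A continuous irreducible representation of a second countable
  group acts on a separable space, hence is unitarily equivalent to one of these.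
\<close>

definition irreps :: "'g::topological_group_add urep set" where
  "irreps = {\<pi>. irreducible_rep \<pi>}"

definition rep_equiv :: "('g::topological_group_add urep \<times> 'g urep) set" where
  "rep_equiv = {(\<rho>, \<pi>). \<rho> \<in> irreps \<and> \<pi> \<in> irreps \<and>
     (\<exists>V \<in> unitaries (rdim \<rho>) (rdim \<pi>). intertwines \<rho> \<pi> V)}"

definition unitary_dual :: "'g::topological_group_add urep set set" where
  "unitary_dual = irreps // rep_equiv"

text \<open>
  The Mackey Borel structure.  On the irreducible representations of a given dimension \<open>n\<close> it is
  generated by the matrix coefficients; different dimensions form disjoint measurable pieces (take
  \<open>B = UNIV\<close>).  The dual carries the quotient structure: a set of classes is measurable iff its
  preimage, i.e. its union, is.
\<close>

definition irreps_algebra :: "'g::topological_group_add urep measure" where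
  "irreps_algebra = sigma irreps
     {{\<pi>\<in>irreps. rdim \<pi> = n \<and> vinner (act \<pi> x u) v \<in> B} | n x u v B.
        u \<in> hilb n \<and> v \<in> hilb n \<and> B \<in> sets borel}"

definition dual_algebra :: "'g::topological_group_add urep set measure" where
  "dual_algebra = sigma unitary_dual {E. E \<subseteq> unitary_dual \<and> \<Union>E \<in> sets irreps_algebra}"

text \<open>
  A measurable choice of a concrete representation in each class of the dual; it turns
  \<open>\<pi> \<mapsto> H\<^sub>\<pi>\<close> into a measurable field of Hilbert spaces.
\<close>

definition measurable_section :: "('g::topological_group_add urep set \<Rightarrow> 'g urep) \<Rightarrow> bool" where
  "measurable_section r \<longleftrightarrow>
     r \<in> dual_algebra \<rightarrow>\<^sub>M irreps_algebra \<and> (\<forall>p\<in>unitary_dual. r p \<in> p)"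

definition commutant :: "'g urep \<Rightarrow> oper set" where
  "commutant \<pi> = {T. intertwines \<pi> \<pi> T}"

definition primary_rep :: "'g::topological_group_add urep \<Rightarrow> bool" where
  "primary_rep \<pi> \<longleftrightarrow>
     unitary_rep \<pi> \<and> rdim \<pi> \<noteq> 0 \<and>
     (\<forall>T\<in>commutant \<pi>. (\<forall>S\<in>commutant \<pi>. T \<circ> S = S \<circ> T) \<longrightarrow>
        (\<exists>c. T = (\<lambda>v i. c * id_op (rdim \<pi>) v i)))"

text \<open>
  \<open>\<pi>\<close> is an (internal, orthogonal, Hilbert space) direct sum of copies of \<open>\<rho>\<close>, the copies being the
  ranges of the isometric intertwiners in \<open>\<V>\<close>.
\<close>

definition sum_of_copies :: "'g urep \<Rightarrow> 'g urep \<Rightarrow> bool" where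
  "sum_of_copies \<rho> \<pi> \<longleftrightarrow>
     (\<exists>\<V>. (\<forall>V\<in>\<V>. V \<in> isometries (rdim \<rho>) (rdim \<pi>) \<and> intertwines \<rho> \<pi> V) \<and>
          (\<forall>V\<in>\<V>. \<forall>W\<in>\<V>. V \<noteq> W \<longrightarrow>
             (\<forall>u\<in>hilb (rdim \<rho>). \<forall>v\<in>hilb (rdim \<rho>). vinner (V u) (W v) = 0)) \<and>
          (\<forall>X. closed_subspace (rdim \<pi>) X \<and> (\<forall>V\<in>\<V>. V ` hilb (rdim \<rho>) \<subseteq> X) \<longrightarrow>
             X = hilb (rdim \<pi>)))"

text \<open>
  For second countable groups it suffices to look at primary representations on separable spaces: a
  primary representation is quasi-equivalent to each of its cyclic subrepresentations.
\<close>

definition type_I :: "'g::topological_group_add itself \<Rightarrow> bool" where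
  "type_I _ \<longleftrightarrow>
     (\<forall>\<pi> :: 'g urep. primary_rep \<pi> \<longrightarrow> (\<exists>\<rho>. irreducible_rep \<rho> \<and> sum_of_copies \<rho> \<pi>))"

text \<open>
  The direct integral over \<open>M\<close> of a family \<open>K\<close> of spaces of Hilbert--Schmidt operators, given by
  representatives.  Vector fields are defined up to null sets, and measurability is that of all matrix
  coefficients, i.e. of the inner products with the matrix units.
\<close>

definition direct_integral :: "'z measure \<Rightarrow> ('z \<Rightarrow> oper set) \<Rightarrow> ('z \<Rightarrow> oper) set" where
  "direct_integral M K = {F.
     (\<forall>i j. (\<lambda>z. vinner (F z (ket j)) (ket i)) \<in> borel_measurable M) \<and>
     (AE z in M. F z \<in> K z) \<and>
     integrable M (\<lambda>z. Re (HS_inner (F z) (F z)))}"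

definition direct_integral_inner :: "'z measure \<Rightarrow> ('z \<Rightarrow> oper) \<Rightarrow> ('z \<Rightarrow> oper) \<Rightarrow> complex" where
  "direct_integral_inner M F E = (\<integral>z. HS_inner (F z) (E z) \<partial>M)"

definition direct_integral_norm :: "'z measure \<Rightarrow> ('z \<Rightarrow> oper) \<Rightarrow> real" where
  "direct_integral_norm M F = sqrt (\<integral>z. Re (HS_inner (F z) (F z)) \<partial>M)"

definition fourier :: "'g measure \<Rightarrow> ('g \<Rightarrow> complex) \<Rightarrow> 'g urep \<Rightarrow> oper" where
  "fourier M f \<pi> = weak_integral (rdim \<pi>) M (\<lambda>x v i. f x * adj (act \<pi> x) v i)"

text \<open>
  \<open>P\<close> is the Plancherel measure for the Haar measure \<open>M\<close>: the Fourier transform maps \<open>L1 \<inter> L2\<close> into the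
  direct integral of the \<open>HS(H\<^sub>\<pi>)\<close> and extends to a unitary map \<open>U\<close> of \<open>L2\<close> onto it.  As elements of
  either space are represented by functions, identities between them hold almost everywhere.
\<close>

definition plancherel_measure ::
  "'g::topological_group_add measure \<Rightarrow> ('g urep set \<Rightarrow> 'g urep) \<Rightarrow> 'g urep set measure \<Rightarrow> bool" where
  "plancherel_measure M r P \<longleftrightarrow>
     sets P = sets dual_algebra \<and>
     (let D = direct_integral P (\<lambda>p. HS (rdim (r p))) in
       (\<forall>f \<in> L1 M \<inter> L2 M. (\<lambda>p. fourier M f (r p)) \<in> D) \<and>
       (\<exists>U. (\<forall>f \<in> L2 M. U f \<in> D) \<and>
            (\<forall>a b. \<forall>f \<in> L2 M. \<forall>g \<in> L2 M.
               AE p in P. U (\<lambda>x. a * f x + b * g x) p = (\<lambda>v. lincomb a (U f p v) b (U g p v))) \<and>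
            (\<forall>f \<in> L2 M. \<forall>g \<in> L2 M. direct_integral_inner P (U f) (U g) = L2_inner M f g) \<and>
            (\<forall>F \<in> D. \<exists>f \<in> L2 M. AE p in P. U f p = F p) \<and>
            (\<forall>f \<in> L1 M \<inter> L2 M. AE p in P. U f p = fourier M f (r p))))"

definition gabor_fibre :: "'g urep \<Rightarrow> 'g \<Rightarrow> oper set" where
  "gabor_fibre \<pi> x = {act \<pi> x \<circ> T | T. T \<in> HS (rdim \<pi>)}"

definition H2_space ::
  "'g measure \<Rightarrow> ('g urep set \<Rightarrow> 'g urep) \<Rightarrow> 'g urep set measure \<Rightarrow> ('g \<times> 'g urep set \<Rightarrow> oper) set" where
  "H2_space M r P = direct_integral (M \<Otimes>\<^sub>M P) (\<lambda>(x, p). gabor_fibre (r p) x)"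

definition H2_norm ::
  "'g measure \<Rightarrow> 'g urep set measure \<Rightarrow> ('g \<times> 'g urep set \<Rightarrow> oper) \<Rightarrow> real" where
  "H2_norm M P F = direct_integral_norm (M \<Otimes>\<^sub>M P) F"

definition gabor ::
  "'g::group_add measure \<Rightarrow> ('g urep set \<Rightarrow> 'g urep) \<Rightarrow> ('g \<Rightarrow> complex) \<Rightarrow> ('g \<Rightarrow> complex) \<Rightarrow>
   'g \<times> 'g urep set \<Rightarrow> oper" where
  "gabor M r \<psi> f = (\<lambda>(x, p). weak_integral (rdim (r p)) M
     (\<lambda>y v i. f y * cnj (\<psi> (- x + y)) * adj (act (r p) y) v i))"

end

theory Submission
  imports Defs
begin

text \<open>
  Fix \<open>x\<close> and put \<open>h x y = f y * cnj (\<psi> (- x + y))\<close>.  As \<open>f\<close> is bounded and square-integrable and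
  \<open>\<psi>\<close> is square-integrable, \<open>h x\<close> lies in \<open>L1 \<inter> L2\<close>, and the Gabor transform at \<open>(x, \<pi>)\<close> is the
  Fourier transform of \<open>h x\<close> at \<open>\<pi>\<close>.  The Plancherel theorem (\<open>plancherel_isometry\<close>) therefore
  evaluates the integral of the squared Hilbert--Schmidt norm over the dual as \<open>\<parallel>h x\<parallel>\<^sup>2\<close>.
  Integrating over \<open>x\<close> gives \<open>\<integral>\<integral> \<bar>f y\<bar>\<^sup>2 \<bar>\<psi> (- x + y)\<bar>\<^sup>2 dy dx\<close>, which is \<open>\<parallel>f\<parallel>\<^sup>2 \<parallel>\<psi>\<parallel>\<^sup>2\<close> by the
  invariance of Haar measure on both sides (\<open>haar_nn_integral_translated_product\<close>).

  This computation rests on four facts.  The weak operator-valued integrals exist, and their entries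
  are scalar integrals (\<open>ex_has_weak_integral\<close>, \<open>fourier_entry\<close>).  These entries are measurable
  jointly in \<open>x\<close> and \<open>\<pi>\<close>, since matrix coefficients are measurable in the representation and
  continuous in the group element (\<open>borel_measurable_caratheodory\<close>, \<open>borel_measurable_fourier_entry\<close>).
  The Plancherel measure is \<open>\<sigma>\<close>-finite, so that Tonelli's theorem holds on the product
  (\<open>plancherel_sigma_finite\<close>): countably many Fourier transforms of square-integrable functions
  suffice to be nonzero at each representation.  Finally, the squared Hilbert--Schmidt norm is read
  off from the entries as an element of \<open>[0, \<infinity>]\<close> (\<open>hs_mass\<close>), so that finiteness of its integral
  also shows that almost every value of the transform is Hilbert--Schmidt and lies in its fibre.
\<close>

section \<open>The Hilbert spaces of square-summable sequences\<close>

lemma hilb_summable: "v \<in> hilb n \<Longrightarrow> summable (\<lambda>i. (cmod (v i))\<^sup>2)"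
  by (simp add: hilb_def)

lemma vnorm_nonneg: "v \<in> hilb n \<Longrightarrow> 0 \<le> vnorm v"
  by (simp add: vnorm_def suminf_nonneg hilb_summable)

lemma vnorm_power2: "v \<in> hilb n \<Longrightarrow> (vnorm v)\<^sup>2 = (\<Sum>i. (cmod (v i))\<^sup>2)"
  by (simp add: vnorm_def suminf_nonneg hilb_summable)

lemma sum_power2_le_vnorm_power2:
  assumes "v \<in> hilb n"
  shows "(\<Sum>i<N. (cmod (v i))\<^sup>2) \<le> (vnorm v)\<^sup>2"
  unfolding vnorm_power2[OF assms] by (rule sum_le_suminf) (use assms hilb_summable in auto)

lemma sum_mult_le_vnorm:
  assumes "u \<in> hilb m" "v \<in> hilb n"
  shows "(\<Sum>i<N. cmod (u i * cnj (v i))) \<le> vnorm u * vnorm v"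
proof -
  have *: "L2_set (\<lambda>i. cmod (w i)) {..<N} \<le> vnorm w" if "w \<in> hilb k" for w k
    using real_sqrt_le_mono[OF sum_power2_le_vnorm_power2[OF that, of N]]
    by (simp add: L2_set_def vnorm_nonneg[OF that])
  have "(\<Sum>i<N. cmod (u i * cnj (v i))) = (\<Sum>i<N. \<bar>cmod (u i)\<bar> * \<bar>cmod (v i)\<bar>)"
    by (simp add: norm_mult)
  also have "\<dots> \<le> L2_set (\<lambda>i. cmod (u i)) {..<N} * L2_set (\<lambda>i. cmod (v i)) {..<N}"
    by (rule L2_set_mult_ineq)
  also have "\<dots> \<le> vnorm u * vnorm v"
    by (intro mult_mono *[OF assms(1)] *[OF assms(2)] vnorm_nonneg[OF assms(1)] L2_set_nonneg)
  finally show ?thesis .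
qed

lemma summable_norm_vinner:
  assumes "u \<in> hilb m" "v \<in> hilb n"
  shows "summable (\<lambda>i. cmod (u i * cnj (v i)))"
  by (rule summableI_nonneg_bounded[OF _ sum_mult_le_vnorm[OF assms]]) simp

lemma summable_vinner:
  assumes "u \<in> hilb m" "v \<in> hilb n"
  shows "summable (\<lambda>i. u i * cnj (v i))"
  using summable_norm_cancel[OF summable_norm_vinner[OF assms]] .

lemma cauchy_schwarz_vinner:
  assumes "u \<in> hilb m" "v \<in> hilb n"
  shows "cmod (vinner u v) \<le> vnorm u * vnorm v"
proof -
  have "cmod (vinner u v) \<le> (\<Sum>i. cmod (u i * cnj (v i)))"
    unfolding vinner_def by (rule summable_norm[OF summable_norm_vinner[OF assms]])
  also have "\<dots> \<le> vnorm u * vnorm v"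
    by (rule suminf_le_const[OF summable_norm_vinner[OF assms] sum_mult_le_vnorm[OF assms]])
  finally show ?thesis .
qed

lemma vinner_self:
  assumes "v \<in> hilb n"
  shows "vinner v v = of_real ((vnorm v)\<^sup>2)"
  unfolding vinner_def vnorm_power2[OF assms]
  by (simp add: suminf_of_real[OF hilb_summable[OF assms]] complex_norm_square[symmetric] flip: of_real_power)

lemma vinner_ket [simp]: "vinner v (ket j) = v j"
proof -
  have "(\<lambda>i. v i * cnj (ket j i)) = (\<lambda>i. if i = j then v i else 0)"
    by (auto simp: ket_def)
  then show ?thesis
    unfolding vinner_def using sums_unique[OF sums_single[of j v]] by simp
qed

lemma ket_vinner [simp]: "vinner (ket j) v = cnj (v j)"
proof -
  have "(\<lambda>i. ket j i * cnj (v i)) = (\<lambda>i. if i = j then cnj (v i) else 0)"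
    by (auto simp: ket_def)
  then show ?thesis
    unfolding vinner_def using sums_unique[OF sums_single[of j "\<lambda>i. cnj (v i)"]] by simp
qed

lemma ket_in_hilb_iff: "ket j \<in> hilb n \<longleftrightarrow> enat j < n"
proof -
  have "(\<lambda>i. (cmod (ket j i))\<^sup>2) = (\<lambda>i. if i = j then 1 else 0)"
    by (auto simp: ket_def)
  then have "summable (\<lambda>i. (cmod (ket j i))\<^sup>2)"
    by simp
  then show ?thesis
    by (force simp: hilb_def ket_def)
qed

lemma vnorm_ket [simp]: "vnorm (ket j) = 1"
proof -
  have "(\<lambda>i. (cmod (ket j i))\<^sup>2) = (\<lambda>i. if i = j then 1 else 0)"
    by (auto simp: ket_def)
  then show ?thesis
    using sums_unique[OF sums_single[of j "\<lambda>_. 1::real"]] by (simp add: vnorm_def)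
qed

lemma vzero_in_hilb: "vzero \<in> hilb n"
  by (simp add: vzero_def hilb_def)

lemma norm_component_le_vnorm: "v \<in> hilb n \<Longrightarrow> cmod (v i) \<le> vnorm v"
  using cauchy_schwarz_vinner[of v n "ket i" \<infinity>] by (simp add: ket_in_hilb_iff)

lemma lincomb_in_hilb:
  assumes "u \<in> hilb n" "v \<in> hilb n"
  shows "lincomb a u b v \<in> hilb n"
proof -
  have bound: "(cmod (a * u i + b * v i))\<^sup>2
      \<le> 2 * (cmod a)\<^sup>2 * (cmod (u i))\<^sup>2 + 2 * (cmod b)\<^sup>2 * (cmod (v i))\<^sup>2" for i
  proof -
    have "(cmod (a * u i + b * v i))\<^sup>2 \<le> (cmod a * cmod (u i) + cmod b * cmod (v i))\<^sup>2"
      using norm_triangle_ineq[of "a * u i" "b * v i"] by (intro power_mono) (auto simp: norm_mult)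
    also have "\<dots> \<le> 2 * (cmod a * cmod (u i))\<^sup>2 + 2 * (cmod b * cmod (v i))\<^sup>2"
      using sum_squares_bound[of "cmod a * cmod (u i)" "cmod b * cmod (v i)"]
      by (simp add: power2_sum)
    finally show ?thesis by (simp add: power_mult_distrib)
  qed
  have "summable (\<lambda>i. 2 * (cmod a)\<^sup>2 * (cmod (u i))\<^sup>2 + 2 * (cmod b)\<^sup>2 * (cmod (v i))\<^sup>2)"
    using assms by (intro summable_add summable_mult hilb_summable)
  then have "summable (\<lambda>i. (cmod (a * u i + b * v i))\<^sup>2)"
    by (rule summable_comparison_test'[where N = 0]) (use bound in auto)
  then show ?thesis
    using assms by (auto simp: hilb_def lincomb_def)
qed

lemma diff_in_hilb: "u \<in> hilb n \<Longrightarrow> v \<in> hilb n \<Longrightarrow> (\<lambda>i. u i - v i) \<in> hilb n"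
  using lincomb_in_hilb[of u n v 1 "-1"] by (simp add: lincomb_def)

lemma scale_in_hilb: "v \<in> hilb n \<Longrightarrow> (\<lambda>i. c * v i) \<in> hilb n"
  using lincomb_in_hilb[of v n v c 0] by (simp add: lincomb_def)

lemma vnorm_scale: "v \<in> hilb n \<Longrightarrow> vnorm (\<lambda>i. c * v i) = cmod c * vnorm v"
  by (simp add: vnorm_def norm_mult power_mult_distrib suminf_mult hilb_summable real_sqrt_mult)

section \<open>Hilbert--Schmidt operators by their entries\<close>

text \<open>
  This holds for an arbitrary function \<open>F\<close>: the pairing with \<open>ket i\<close> only picks out one coordinate.
  Hence \<open>HS_inner F F\<close> depends measurably on the entries of \<open>F\<close> even where \<open>F\<close> is not
  Hilbert--Schmidt, where the series need not converge.
\<close>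

lemma HS_inner_self:
  "HS_inner F F = (\<Sum>i. \<Sum>k. F (ket i) k * cnj (F (ket i) k))"
  by (simp add: HS_inner_def tr_def adj_def) (simp add: vinner_def)

text \<open>
  The squared Hilbert--Schmidt norm with values in \<open>[0, \<infinity>]\<close>.  Unlike \<open>Re (HS_inner F F)\<close> it is
  meaningful for every \<open>F\<close>, so Tonelli can be applied to it before the operators in question are
  known to be Hilbert--Schmidt; its finiteness then yields that they are.
\<close>

definition hs_mass :: "oper \<Rightarrow> ennreal" where
  "hs_mass F = (\<Sum>i. \<Sum>k. ennreal ((cmod (F (ket i) k))\<^sup>2))"

lemma bounded_ops_in_hilb: "T \<in> bounded_ops m n \<Longrightarrow> T v \<in> hilb n"
  by (cases "v \<in> hilb m") (auto simp: bounded_ops_def vzero_in_hilb)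

lemma hs_mass_bounded_ops:
  assumes "F \<in> bounded_ops n n"
  shows "hs_mass F = (\<Sum>i. ennreal ((vnorm (F (ket i)))\<^sup>2))"
  unfolding hs_mass_def
proof (intro suminf_cong)
  fix i
  have F: "F (ket i) \<in> hilb n"
    using assms by (rule bounded_ops_in_hilb)
  show "(\<Sum>k. ennreal ((cmod (F (ket i) k))\<^sup>2)) = ennreal ((vnorm (F (ket i)))\<^sup>2)"
    unfolding vnorm_power2[OF F] by (rule suminf_ennreal2) (simp_all add: hilb_summable[OF F])
qed

lemma HS_iff_hs_mass_finite:
  assumes "F \<in> bounded_ops n n"
  shows "F \<in> HS n \<longleftrightarrow> hs_mass F < \<infinity>"
proof
  assume "F \<in> HS n"
  then have "summable (\<lambda>i. (vnorm (F (ket i)))\<^sup>2)"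
    by (simp add: HS_def)
  then show "hs_mass F < \<infinity>"
    by (simp add: hs_mass_bounded_ops[OF assms] suminf_ennreal2)
next
  assume "hs_mass F < \<infinity>"
  then have "summable (\<lambda>i. (vnorm (F (ket i)))\<^sup>2)"
    unfolding hs_mass_bounded_ops[OF assms] by (intro summable_suminf_not_top) auto
  then show "F \<in> HS n"
    using assms by (simp add: HS_def)
qed

lemma HS_inner_self_HS:
  assumes "F \<in> HS n"
  shows "HS_inner F F = of_real (\<Sum>i. (vnorm (F (ket i)))\<^sup>2)"
proof -
  have F: "F \<in> bounded_ops n n" "summable (\<lambda>i. (vnorm (F (ket i)))\<^sup>2)"
    using assms by (auto simp: HS_def)
  have "HS_inner F F = (\<Sum>i. of_real ((vnorm (F (ket i)))\<^sup>2))"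
    using vinner_self[OF bounded_ops_in_hilb[OF F(1)]]
    by (simp add: HS_inner_self vinner_def)
  also have "\<dots> = of_real (\<Sum>i. (vnorm (F (ket i)))\<^sup>2)"
    using suminf_of_real[OF F(2), where ?'a = complex] by simp
  finally show ?thesis .
qed

lemma hs_mass_eq_HS_inner:
  assumes "F \<in> HS n"
  shows "hs_mass F = ennreal (Re (HS_inner F F))" "0 \<le> Re (HS_inner F F)"
    "Im (HS_inner F F) = 0"
proof -
  have F: "F \<in> bounded_ops n n" "summable (\<lambda>i. (vnorm (F (ket i)))\<^sup>2)"
    using assms by (auto simp: HS_def)
  show "hs_mass F = ennreal (Re (HS_inner F F))"
    by (simp add: hs_mass_bounded_ops[OF F(1)] HS_inner_self_HS[OF assms] suminf_ennreal2 F(2))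
  show "0 \<le> Re (HS_inner F F)" "Im (HS_inner F F) = 0"
    by (simp_all add: HS_inner_self_HS[OF assms] suminf_nonneg F(2))
qed

lemma norm_entry_le_HS_inner:
  assumes "F \<in> HS n"
  shows "(cmod (F (ket j) i))\<^sup>2 \<le> Re (HS_inner F F)"
proof -
  have F: "F \<in> bounded_ops n n" "summable (\<lambda>i. (vnorm (F (ket i)))\<^sup>2)"
    using assms by (auto simp: HS_def)
  have "(cmod (F (ket j) i))\<^sup>2 \<le> (vnorm (F (ket j)))\<^sup>2"
    by (intro power_mono norm_component_le_vnorm[OF bounded_ops_in_hilb[OF F(1)]]) simp
  also have "\<dots> = (\<Sum>i\<in>{j}. (vnorm (F (ket i)))\<^sup>2)" by simp
  also have "\<dots> \<le> (\<Sum>i. (vnorm (F (ket i)))\<^sup>2)"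
    by (rule sum_le_suminf) (use F in auto)
  finally show ?thesis by (simp add: HS_inner_self_HS[OF assms])
qed

section \<open>Weak integrals\<close>

lemma has_weak_integral_unique:
  assumes "has_weak_integral n M A S" "has_weak_integral n M A T"
  shows "S = T"
proof (intro ext)
  fix u i
  have S: "S \<in> bounded_ops n n" and T: "T \<in> bounded_ops n n"
    using assms by (auto simp: has_weak_integral_def)
  show "S u i = T u i"
  proof (cases "u \<in> hilb n \<and> enat i < n")
    case True
    then have "vinner (S u) (ket i) = vinner (T u) (ket i)"
      using assms by (simp add: has_weak_integral_def ket_in_hilb_iff del: vinner_ket)
    then show ?thesis by simp
  next
    case False
    then consider "u \<notin> hilb n" | "n \<le> enat i" by force
    then show ?thesis
    proof cases
      case 1
      then show ?thesis using S T by (simp add: bounded_ops_def)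
    next
      case 2
      then show ?thesis
        using bounded_ops_in_hilb[OF S, of u] bounded_ops_in_hilb[OF T, of u] by (simp add: hilb_def)
    qed
  qed
qed

lemma weak_integral_eq: "has_weak_integral n M A T \<Longrightarrow> weak_integral n M A = T"
  unfolding weak_integral_def using has_weak_integral_unique by blast

text \<open>
  The operator is built by integrating coordinates: \<open>(T u) i = \<integral> (A x u) i\<close>.  That \<open>T u\<close> is
  square-summable follows by duality, pairing it with its own truncation \<open>w\<close>: this gives
  \<open>\<parallel>w\<parallel>\<^sup>2 \<le> (\<integral> b) \<parallel>u\<parallel> \<parallel>w\<parallel>\<close>, so that all truncations have norm at most \<open>(\<integral> b) \<parallel>u\<parallel>\<close>.  The weak
  identity against a general vector is the limit of the one against its truncations, by dominated
  convergence.
\<close>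

lemma ex_has_weak_integral:
  assumes hilb: "\<And>x u. u \<in> hilb n \<Longrightarrow> A x u \<in> hilb n"
    and lin: "\<And>x a b u v. u \<in> hilb n \<Longrightarrow> v \<in> hilb n \<Longrightarrow>
      A x (lincomb a u b v) = lincomb a (A x u) b (A x v)"
    and bound: "\<And>x u. u \<in> hilb n \<Longrightarrow> vnorm (A x u) \<le> b x * vnorm u"
    and b: "integrable M b" "\<And>x. 0 \<le> b x"
    and meas: "\<And>u i. u \<in> hilb n \<Longrightarrow> (\<lambda>x. A x u i) \<in> borel_measurable M"
  shows "\<exists>T. has_weak_integral n M A T"
proof -
  define T :: oper where "T = (\<lambda>u. if u \<in> hilb n then (\<lambda>i. \<integral>x. A x u i \<partial>M) else vzero)"
  define C where "C = (\<integral>x. b x \<partial>M)"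
  have C: "0 \<le> C" unfolding C_def using b by simp
  have int_comp: "integrable M (\<lambda>x. A x u i)" if u: "u \<in> hilb n" for u i
  proof (rule Bochner_Integration.integrable_bound)
    show "integrable M (\<lambda>x. b x * vnorm u)" using b by simp
    show "AE x in M. norm (A x u i) \<le> norm (b x * vnorm u)"
      using order_trans[OF norm_component_le_vnorm[OF hilb[OF u]] bound[OF u]]
      by (auto intro!: AE_I2 order_trans[OF _ abs_ge_self])
  qed (rule meas[OF u])
  have partial: "(\<Sum>i<N. T u i * cnj (v i)) = (\<integral>x. (\<Sum>i<N. A x u i * cnj (v i)) \<partial>M)"
    if u: "u \<in> hilb n" for u v N
    using u by (subst Bochner_Integration.integral_sum) (auto simp: T_def int_comp)
  have vmeas: "(\<lambda>x. vinner (A x u) v) \<in> borel_measurable M" if u: "u \<in> hilb n" for u v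
    unfolding vinner_def using meas[OF u] by measurable
  have T_partial: "(\<Sum>i<N. (cmod (T u i))\<^sup>2) \<le> (C * vnorm u)\<^sup>2" if u: "u \<in> hilb n" for u N
  proof -
    define w where "w = (\<lambda>i. if i < N then T u i else 0)"
    have sums: "(\<lambda>i. (cmod (w i))\<^sup>2) sums (\<Sum>i<N. (cmod (T u i))\<^sup>2)"
      using sums_finite[of "{..<N}" "\<lambda>i. (cmod (w i))\<^sup>2"] by (simp add: w_def)
    then have w: "w \<in> hilb \<infinity>"
      by (auto simp: hilb_def sums_iff)
    have wn: "(vnorm w)\<^sup>2 = (\<Sum>i<N. (cmod (T u i))\<^sup>2)"
      using sums by (simp add: vnorm_power2[OF w] sums_iff)
    have vw: "vinner (A x u) w = (\<Sum>i<N. A x u i * cnj (T u i))" for x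
      using sums_finite[of "{..<N}" "\<lambda>i. A x u i * cnj (w i)"]
      by (simp add: w_def vinner_def sums_iff)
    have bw: "cmod (vinner (A x u) w) \<le> b x * (vnorm u * vnorm w)" for x
      using order_trans[OF cauchy_schwarz_vinner[OF hilb[OF u] w]
          mult_right_mono[OF bound[OF u] vnorm_nonneg[OF w]]]
      by (simp add: mult.assoc)
    have "complex_of_real ((vnorm w)\<^sup>2) = (\<Sum>i<N. T u i * cnj (T u i))"
      by (simp add: wn complex_norm_square del: of_real_power)
    also have "\<dots> = (\<integral>x. vinner (A x u) w \<partial>M)"
      by (simp add: partial[OF u] vw)
    finally have "(vnorm w)\<^sup>2 = cmod (\<integral>x. vinner (A x u) w \<partial>M)"
      by (metis norm_of_real abs_of_nonneg zero_le_power2)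
    also have "\<dots> \<le> (\<integral>x. cmod (vinner (A x u) w) \<partial>M)"
      by (rule integral_norm_bound)
    also have "\<dots> \<le> (\<integral>x. b x * (vnorm u * vnorm w) \<partial>M)"
      using b bw by (intro integral_mono') (auto simp: vnorm_nonneg[OF u] vnorm_nonneg[OF w])
    also have "\<dots> = C * vnorm u * vnorm w"
      by (simp add: C_def)
    finally have "vnorm w * vnorm w \<le> (C * vnorm u) * vnorm w"
      by (simp add: power2_eq_square)
    then have "vnorm w \<le> C * vnorm u"
      using C vnorm_nonneg[OF w] vnorm_nonneg[OF u]
      by (cases "vnorm w = 0") (auto simp: mult_le_cancel_right)
    then show ?thesis
      unfolding wn[symmetric] by (intro power_mono vnorm_nonneg[OF w])
  qed
  have T_hilb: "T u \<in> hilb n" if u: "u \<in> hilb n" for u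
  proof -
    have "summable (\<lambda>i. (cmod (T u i))\<^sup>2)"
      by (rule summableI_nonneg_bounded[OF _ T_partial[OF u]]) simp
    moreover have "T u i = 0" if "n \<le> enat i" for i
      using hilb[OF u] that u by (simp add: T_def hilb_def)
    ultimately show ?thesis by (simp add: hilb_def)
  qed
  have T_bound: "vnorm (T u) \<le> C * vnorm u" if u: "u \<in> hilb n" for u
  proof (rule power2_le_imp_le)
    show "(vnorm (T u))\<^sup>2 \<le> (C * vnorm u)\<^sup>2"
      unfolding vnorm_power2[OF T_hilb[OF u]]
      by (rule suminf_le_const[OF hilb_summable[OF T_hilb[OF u]] T_partial[OF u]])
  qed (simp add: C vnorm_nonneg[OF u])
  have T_ops: "T \<in> bounded_ops n n"
  proof -
    have "T (lincomb a u b v) = lincomb a (T u) b (T v)" if "u \<in> hilb n" "v \<in> hilb n" for a b u v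
      using that lincomb_in_hilb[OF that, of a b]
      by (auto simp: T_def lin int_comp lincomb_def[of _ "A _ _"] lincomb_def[of _ "\<lambda>i. \<integral>x. A x _ i \<partial>M"])
    moreover have "T v = vzero" if "v \<notin> hilb n" for v
      using that by (simp add: T_def)
    ultimately show ?thesis
      using T_hilb T_bound unfolding bounded_ops_def by blast
  qed
  have "integrable M (\<lambda>x. vinner (A x u) v) \<and> vinner (T u) v = (\<integral>x. vinner (A x u) v \<partial>M)"
    if u: "u \<in> hilb n" and v: "v \<in> hilb n" for u v
  proof -
    let ?w = "\<lambda>x. b x * (vnorm u * vnorm v)"
    have lim: "AE x in M. (\<lambda>N. \<Sum>i<N. A x u i * cnj (v i)) \<longlonglongrightarrow> vinner (A x u) v"
      unfolding vinner_def by (intro AE_I2 summable_LIMSEQ summable_vinner[OF hilb[OF u] v])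
    have dom: "AE x in M. norm (\<Sum>i<N. A x u i * cnj (v i)) \<le> ?w x" for N
      using order_trans[OF sum_mult_le_vnorm[OF hilb[OF u] v]
          mult_right_mono[OF bound[OF u] vnorm_nonneg[OF v]]]
      by (intro AE_I2 order_trans[OF norm_sum]) (simp add: mult.assoc)
    have sm: "(\<lambda>x. \<Sum>i<N. A x u i * cnj (v i)) \<in> borel_measurable M" for N
      using meas[OF u] by measurable
    have w: "integrable M ?w" using b by simp
    have "(\<lambda>N. \<Sum>i<N. T u i * cnj (v i)) \<longlonglongrightarrow> (\<integral>x. vinner (A x u) v \<partial>M)"
      unfolding partial[OF u]
      by (rule integral_dominated_convergence[OF vmeas[OF u] sm w lim dom])
    moreover have "(\<lambda>N. \<Sum>i<N. T u i * cnj (v i)) \<longlonglongrightarrow> vinner (T u) v"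
      unfolding vinner_def by (intro summable_LIMSEQ summable_vinner[OF T_hilb[OF u] v])
    ultimately show ?thesis
      using integrable_dominated_convergence[OF vmeas[OF u] sm w lim dom] LIMSEQ_unique by blast
  qed
  then show ?thesis
    using T_ops by (auto simp: has_weak_integral_def)
qed

section \<open>Unitary representations\<close>

lemma act_bounded_ops: "unitary_rep \<pi> \<Longrightarrow> act \<pi> x \<in> bounded_ops (rdim \<pi>) (rdim \<pi>)"
  by (auto simp: unitary_rep_def unitaries_def isometries_def)

lemma act_in_hilb: "unitary_rep \<pi> \<Longrightarrow> act \<pi> x v \<in> hilb (rdim \<pi>)"
  using bounded_ops_in_hilb act_bounded_ops by blast

lemma act_outside: "unitary_rep \<pi> \<Longrightarrow> v \<notin> hilb (rdim \<pi>) \<Longrightarrow> act \<pi> x v = vzero"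
  using act_bounded_ops[of \<pi> x] by (simp add: bounded_ops_def)

lemma bounded_ops_vzero:
  assumes "T \<in> bounded_ops m n"
  shows "T vzero = vzero"
proof -
  have "T (lincomb 0 vzero 0 vzero) = lincomb 0 (T vzero) 0 (T vzero)"
    using assms vzero_in_hilb[of m] unfolding bounded_ops_def by blast
  then show ?thesis by (simp add: lincomb_def vzero_def)
qed

lemma vinner_act:
  "unitary_rep \<pi> \<Longrightarrow> u \<in> hilb (rdim \<pi>) \<Longrightarrow> v \<in> hilb (rdim \<pi>) \<Longrightarrow>
    vinner (act \<pi> x u) (act \<pi> x v) = vinner u v"
  by (auto simp: unitary_rep_def unitaries_def isometries_def)

lemma vnorm_act:
  assumes "unitary_rep \<pi>" "v \<in> hilb (rdim \<pi>)"
  shows "vnorm (act \<pi> x v) = vnorm v"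
proof -
  have "complex_of_real ((vnorm (act \<pi> x v))\<^sup>2) = of_real ((vnorm v)\<^sup>2)"
    using vinner_self[OF act_in_hilb[OF assms(1), of x v]] vinner_self[OF assms(2)]
      vinner_act[OF assms(1,2,2)] by metis
  then have "(vnorm (act \<pi> x v))\<^sup>2 = (vnorm v)\<^sup>2"
    using of_real_eq_iff by blast
  then show ?thesis
    using vnorm_nonneg[OF assms(2)] vnorm_nonneg[OF act_in_hilb[OF assms(1)]] by simp
qed

lemma act_add: "unitary_rep \<pi> \<Longrightarrow> act \<pi> (x + y) v = act \<pi> x (act \<pi> y v)"
  by (simp add: unitary_rep_def)

lemma act_zero:
  assumes "unitary_rep \<pi>" "v \<in> hilb (rdim \<pi>)"
  shows "act \<pi> 0 v = v"
proof -
  have "v \<in> act \<pi> 0 ` hilb (rdim \<pi>)"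
    using assms by (simp add: unitary_rep_def unitaries_def)
  then obtain w where "v = act \<pi> 0 w" by blast
  then show ?thesis
    using act_add[OF assms(1), of 0 0 w] by simp
qed

text \<open>
  Both sides vanish in the coordinates \<open>i \<ge> rdim \<pi>\<close>; below, this is unitarity of \<open>act \<pi> x\<close>.
\<close>

lemma adj_act:
  assumes "unitary_rep \<pi>" "v \<in> hilb (rdim \<pi>)"
  shows "adj (act \<pi> x) v = act \<pi> (- x) v"
proof
  fix i
  show "adj (act \<pi> x) v i = act \<pi> (- x) v i"
  proof (cases "enat i < rdim \<pi>")
    case True
    have "v = act \<pi> x (act \<pi> (- x) v)"
      using act_zero[OF assms] act_add[OF assms(1), of x "- x" v] by simp
    then have "adj (act \<pi> x) v i = vinner (act \<pi> x (act \<pi> (- x) v)) (act \<pi> x (ket i))"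
      by (simp add: adj_def)
    also have "\<dots> = act \<pi> (- x) v i"
      using True by (simp add: vinner_act[OF assms(1) act_in_hilb[OF assms(1)]] ket_in_hilb_iff)
    finally show ?thesis .
  next
    case False
    then have "act \<pi> x (ket i) = vzero"
      by (intro act_outside[OF assms(1)]) (simp add: ket_in_hilb_iff)
    moreover have "act \<pi> (- x) v i = 0"
      using act_in_hilb[OF assms(1), of "- x" v] False by (simp add: hilb_def)
    ultimately show ?thesis
      by (simp add: adj_def vinner_def vzero_def)
  qed
qed

lemma continuous_on_act_entry:
  assumes "unitary_rep \<pi>"
  shows "continuous_on UNIV (\<lambda>x. act \<pi> x v i)"
proof (cases "v \<in> hilb (rdim \<pi>)")
  case False
  then show ?thesis by (simp add: act_outside[OF assms])
next
  case True
  have "((\<lambda>x. act \<pi> x v i) \<longlongrightarrow> act \<pi> x0 v i) (at x0)" for x0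
  proof (rule LIM_zero_cancel, rule Lim_null_comparison)
    show "((\<lambda>x. vnorm (\<lambda>i. act \<pi> x v i - act \<pi> x0 v i)) \<longlongrightarrow> 0) (at x0)"
      using assms True by (simp add: unitary_rep_def)
    show "\<forall>\<^sub>F x in at x0. norm (act \<pi> x v i - act \<pi> x0 v i) \<le> vnorm (\<lambda>i. act \<pi> x v i - act \<pi> x0 v i)"
      using norm_component_le_vnorm[OF diff_in_hilb[OF act_in_hilb[OF assms] act_in_hilb[OF assms]]]
      by (intro always_eventually allI)
  qed
  then show ?thesis
    by (simp add: continuous_on_def)
qed

section \<open>The operator-valued Fourier transform\<close>

text \<open>
  For integrable \<open>h\<close> the integrand is bounded in norm by \<open>\<bar>h\<bar>\<close>, because the representation is unitary.
\<close>

lemma has_weak_integral_fourier: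
  fixes \<pi> :: "'g::topological_group_add urep"
  assumes \<pi>: "unitary_rep \<pi>" and M: "sets M = sets borel" and h: "integrable M h"
  shows "has_weak_integral (rdim \<pi>) M (\<lambda>x v i. h x * adj (act \<pi> x) v i) (fourier M h \<pi>)"
proof -
  have "\<exists>T. has_weak_integral (rdim \<pi>) M (\<lambda>x v i. h x * adj (act \<pi> x) v i) T"
  proof (rule ex_has_weak_integral[where b = "\<lambda>x. cmod (h x)"])
    show "(\<lambda>i. h x * adj (act \<pi> x) u i) \<in> hilb (rdim \<pi>)" if "u \<in> hilb (rdim \<pi>)" for x u
      using that by (simp add: adj_act[OF \<pi>] scale_in_hilb act_in_hilb[OF \<pi>])
    show "vnorm (\<lambda>i. h x * adj (act \<pi> x) u i) \<le> cmod (h x) * vnorm u"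
      if "u \<in> hilb (rdim \<pi>)" for x u
      using that by (simp add: adj_act[OF \<pi>] vnorm_scale[OF act_in_hilb[OF \<pi>]] vnorm_act[OF \<pi>])
    show "(\<lambda>i. h x * adj (act \<pi> x) (lincomb a u b v) i) =
        lincomb a (\<lambda>i. h x * adj (act \<pi> x) u i) b (\<lambda>i. h x * adj (act \<pi> x) v i)"
      if "u \<in> hilb (rdim \<pi>)" "v \<in> hilb (rdim \<pi>)" for x a b u v
    proof -
      have "act \<pi> (- x) (lincomb a u b v) = lincomb a (act \<pi> (- x) u) b (act \<pi> (- x) v)"
        using act_bounded_ops[OF \<pi>, of "- x"] that unfolding bounded_ops_def by blast
      then show ?thesis
        using that by (simp add: adj_act[OF \<pi>] lincomb_in_hilb) (simp add: lincomb_def algebra_simps)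
    qed
    show "(\<lambda>x. h x * adj (act \<pi> x) u i) \<in> borel_measurable M" if "u \<in> hilb (rdim \<pi>)" for u i
    proof -
      have "continuous_on UNIV (\<lambda>x. act \<pi> (- x) u i)"
        using continuous_on_compose2[OF continuous_on_act_entry[OF \<pi>]
            continuous_on_minus[OF continuous_on_id]] by simp
      then have "(\<lambda>x. act \<pi> (- x) u i) \<in> borel_measurable M"
        unfolding measurable_cong_sets[OF M refl] by (rule borel_measurable_continuous_onI)
      then show ?thesis
        using that h by (simp add: adj_act[OF \<pi>])
    qed
  qed (use h in auto)
  then obtain T where "has_weak_integral (rdim \<pi>) M (\<lambda>x v i. h x * adj (act \<pi> x) v i) T" ..
  then show ?thesis
    unfolding fourier_def by (simp add: weak_integral_eq)
qed

lemma fourier_bounded_ops: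
  fixes \<pi> :: "'g::topological_group_add urep"
  assumes "unitary_rep \<pi>" "sets M = sets borel" "integrable M h"
  shows "fourier M h \<pi> \<in> bounded_ops (rdim \<pi>) (rdim \<pi>)"
  using has_weak_integral_fourier[OF assms] by (simp add: has_weak_integral_def)

text \<open>
  Also correct for indices beyond the dimension of \<open>\<pi>\<close>, where both sides are zero; so in
  measurability arguments the dimension, which varies with \<open>\<pi>\<close>, need not be mentioned.
\<close>

lemma fourier_entry:
  fixes \<pi> :: "'g::topological_group_add urep"
  assumes \<pi>: "unitary_rep \<pi>" and M: "sets M = sets borel" and h: "integrable M h"
  shows "fourier M h \<pi> (ket j) i = (\<integral>x. h x * cnj (act \<pi> x (ket i) j) \<partial>M)"
proof -
  have adj: "adj (act \<pi> x) (ket j) i = cnj (act \<pi> x (ket i) j)" for x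
    by (simp add: adj_def)
  consider "enat i < rdim \<pi>" "enat j < rdim \<pi>" | "rdim \<pi> \<le> enat j" | "rdim \<pi> \<le> enat i"
    by force
  then show ?thesis
  proof cases
    case 1
    then have "vinner (fourier M h \<pi> (ket j)) (ket i) =
        (\<integral>x. vinner (\<lambda>i. h x * adj (act \<pi> x) (ket j) i) (ket i) \<partial>M)"
      using has_weak_integral_fourier[OF assms]
      by (simp add: has_weak_integral_def ket_in_hilb_iff del: vinner_ket)
    then show ?thesis by (simp add: adj)
  next
    case 2
    then have "fourier M h \<pi> (ket j) = vzero"
      using fourier_bounded_ops[OF assms] by (simp add: bounded_ops_def ket_in_hilb_iff)
    moreover have "act \<pi> x (ket i) j = 0" for x
      using act_in_hilb[OF \<pi>, of x "ket i"] 2 by (simp add: hilb_def)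
    ultimately show ?thesis by (simp add: vzero_def)
  next
    case 3
    have "fourier M h \<pi> (ket j) i = 0"
      using bounded_ops_in_hilb[OF fourier_bounded_ops[OF assms], of "ket j"] 3 by (simp add: hilb_def)
    moreover have "act \<pi> x (ket i) = vzero" for x
      using 3 by (simp add: act_outside[OF \<pi>] ket_in_hilb_iff)
    ultimately show ?thesis by (simp add: vzero_def)
  qed
qed

section \<open>Joint measurability over the group and its dual\<close>

text \<open>
  The points \<open>d m\<close> run through a countable dense set.  The condition says that \<open>y\<close> lies in the translate
  \<open>d m + U\<close>, so countably many translates of any nonempty open set cover the group.
\<close>

lemma dense_translates_cover:
  obtains d :: "nat \<Rightarrow> 'g::{topological_group_add, second_countable_topology}"
  where "\<And>U y. open U \<Longrightarrow> U \<noteq> {} \<Longrightarrow> \<exists>m. - d m + y \<in> U"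
proof -
  obtain D :: "'g set" where D: "countable D" "\<And>X. open X \<Longrightarrow> X \<noteq> {} \<Longrightarrow> \<exists>d\<in>D. d \<in> X"
    by (rule countable_dense_setE) blast
  have ne: "D \<noteq> {}" using D(2)[of UNIV] by auto
  show thesis
  proof
    fix U :: "'g set" and y
    assume U: "open U" "U \<noteq> {}"
    then obtain u where u: "u \<in> U" by blast
    have "open ((\<lambda>z. - z + y) -` U)"
      by (intro open_vimage U continuous_intros)
    moreover have "y - u \<in> (\<lambda>z. - z + y) -` U"
      using u by simp
    ultimately obtain z where "z \<in> D" "- z + y \<in> U"
      using D(2) by blast
    then show "\<exists>m. - from_nat_into D m + y \<in> U"
      using from_nat_into_surj[OF D(1)] by metis
  qed
qed

text \<open>
  A function measurable in one variable and continuous in the other is jointly measurable.  No metric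
  on the group is required: a neighbourhood basis \<open>A k\<close> of the neutral element serves as a scale.
  Replacing \<open>y\<close> by the first point \<open>d m\<close> of a dense sequence with \<open>- d m + y \<in> A k\<close> gives
  approximations that depend on \<open>y\<close> only through a measurable natural number, and they converge to
  \<open>c p y\<close> by continuity.
\<close>

lemma borel_measurable_caratheodory:
  fixes c :: "'a \<Rightarrow> 'g::{topological_group_add, t2_space, second_countable_topology} \<Rightarrow> complex"
  assumes meas: "\<And>y. (\<lambda>p. c p y) \<in> borel_measurable P"
    and cont: "\<And>p. p \<in> space P \<Longrightarrow> continuous_on UNIV (c p)"
  shows "(\<lambda>(p, y). c p y) \<in> borel_measurable (P \<Otimes>\<^sub>M borel)"
proof -
  obtain d :: "nat \<Rightarrow> 'g" where d: "\<And>U y. open U \<Longrightarrow> U \<noteq> {} \<Longrightarrow> \<exists>m. - d m + y \<in> U"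
    by (rule dense_translates_cover) blast
  obtain A :: "nat \<Rightarrow> 'g set" where A: "\<And>k. open (A k)" "\<And>k. 0 \<in> A k"
      "\<And>S. open S \<Longrightarrow> 0 \<in> S \<Longrightarrow> eventually (\<lambda>k. A k \<subseteq> S) sequentially"
    by (rule countable_basis_at_decseq[of "0 :: 'g"]) blast
  define m where "m k y = (LEAST m. - d m + y \<in> A k)" for k y
  have m: "- d (m k y) + y \<in> A k" for k y
    unfolding m_def by (rule LeastI_ex) (use d A in blast)
  have m_meas: "m k \<in> borel \<rightarrow>\<^sub>M count_space UNIV" for k
  proof -
    have "(\<lambda>y. - d j + y \<in> A k) \<in> borel \<rightarrow>\<^sub>M count_space UNIV" for j
    proof (unfold Measurable.pred_def)
      have "open ((\<lambda>y. - d j + y) -` A k)"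
        by (intro open_vimage A continuous_intros)
      then show "{y \<in> space borel. - d j + y \<in> A k} \<in> sets borel"
        by (simp add: vimage_def)
    qed
    then show ?thesis
      unfolding m_def by (rule measurable_Least)
  qed
  show ?thesis
  proof (rule borel_measurable_LIMSEQ_metric)
    fix k
    have "(\<lambda>z. c (fst z) (d j)) \<in> borel_measurable (P \<Otimes>\<^sub>M borel)" for j
      using measurable_compose[OF measurable_fst meas] .
    then show "(\<lambda>z. c (fst z) (d (m k (snd z)))) \<in> borel_measurable (P \<Otimes>\<^sub>M borel)"
      by (rule measurable_compose_countable) (rule measurable_compose[OF measurable_snd m_meas])
  next
    fix z assume z: "z \<in> space (P \<Otimes>\<^sub>M (borel :: 'g measure))"
    obtain p y where [simp]: "z = (p, y)" by (cases z)
    have p: "p \<in> space P" using z by (simp add: space_pair_measure)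
    have "(\<lambda>k. - d (m k y) + y) \<longlonglongrightarrow> 0"
      unfolding tendsto_def
    proof safe
      fix S :: "'g set" assume "open S" "0 \<in> S"
      then have "eventually (\<lambda>k. A k \<subseteq> S) sequentially" by (rule A(3))
      then show "eventually (\<lambda>k. - d (m k y) + y \<in> S) sequentially"
        by eventually_elim (use m in blast)
    qed
    then have "(\<lambda>k. y + - (- d (m k y) + y)) \<longlonglongrightarrow> y + - 0"
      by (intro tendsto_add tendsto_const tendsto_minus)
    then have "(\<lambda>k. d (m k y)) \<longlonglongrightarrow> y"
      by (simp add: minus_add add.assoc[symmetric])
    then show "(\<lambda>k. c (fst z) (d (m k (snd z)))) \<longlonglongrightarrow> (case z of (p, y) \<Rightarrow> c p y)"
      using continuous_on_tendsto_compose[OF cont[OF p]] by simp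
  qed
qed

lemma space_irreps_algebra: "space irreps_algebra = irreps"
  by (simp add: irreps_algebra_def space_measure_of_conv)

text \<open>
  The generators of the Mackey structure use vectors of \<open>hilb n\<close> for one fixed dimension \<open>n\<close>.  Replacing
  \<open>ket i\<close> by the zero vector when \<open>i \<ge> n\<close> does not change the entry, and countably many dimensions
  are glued together.
\<close>

lemma borel_measurable_irreps_entry:
  "(\<lambda>\<pi>. act \<pi> x (ket j) i) \<in> borel_measurable (irreps_algebra :: 'g::topological_group_add urep measure)"
proof (rule measurableI)
  fix B :: "complex set" assume B: "B \<in> sets borel"
  \<comment> \<open>The basis vectors, with those outside \<open>hilb n\<close> replaced by zero.\<close>
  define cut where "cut n i = (if enat i < n then ket i else vzero)" for n i
  have cut: "cut n i \<in> hilb n" for n i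
    by (simp add: cut_def ket_in_hilb_iff vzero_in_hilb)
  let ?E = "\<lambda>n. {\<pi> \<in> irreps :: 'g urep set. rdim \<pi> = n \<and> vinner (act \<pi> x (cut n j)) (cut n i) \<in> B}"
  have entry: "vinner (act \<pi> x (cut (rdim \<pi>) j)) (cut (rdim \<pi>) i) = act \<pi> x (ket j) i"
    if "\<pi> \<in> irreps" for \<pi> :: "'g urep"
  proof -
    have \<pi>: "unitary_rep \<pi>" using that by (simp add: irreps_def irreducible_rep_def)
    have "act \<pi> x (cut (rdim \<pi>) j) = act \<pi> x (ket j)"
      by (auto simp: cut_def bounded_ops_vzero[OF act_bounded_ops[OF \<pi>]] act_outside[OF \<pi>] ket_in_hilb_iff)
    moreover have "vinner w (cut (rdim \<pi>) i) = w i" if "w \<in> hilb (rdim \<pi>)" for w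
    proof (cases "enat i < rdim \<pi>")
      case False
      then have "w i = 0" using that by (simp add: hilb_def)
      then show ?thesis using False by (simp add: cut_def vinner_def vzero_def)
    qed (simp add: cut_def)
    ultimately show ?thesis using act_in_hilb[OF \<pi>] by simp
  qed
  have gen: "?E n \<in> sets irreps_algebra" for n
  proof -
    have "?E n \<in> {{\<pi>\<in>irreps. rdim \<pi> = n \<and> vinner (act \<pi> x u) v \<in> B} | n x u v B.
        u \<in> hilb n \<and> v \<in> hilb n \<and> B \<in> sets borel}"
      using cut B by blast
    then show ?thesis
      unfolding irreps_algebra_def by (intro in_measure_of) auto
  qed
  have "(\<lambda>\<pi>. act \<pi> x (ket j) i) -` B \<inter> space irreps_algebra = (\<Union>n. ?E n)"
    using entry by (auto simp: space_irreps_algebra)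
  then show "(\<lambda>\<pi>. act \<pi> x (ket j) i) -` B \<inter> space irreps_algebra \<in> sets irreps_algebra"
    using sets.countable_UN[of ?E UNIV irreps_algebra] gen by auto
qed simp

lemma measurable_section_dual:
  assumes "measurable_section r" "sets P = sets dual_algebra"
  shows "r \<in> P \<rightarrow>\<^sub>M irreps_algebra"
  using assms by (simp add: measurable_section_def measurable_cong_sets[OF assms(2) refl])

lemma section_irreducible:
  assumes "measurable_section r" "sets P = sets dual_algebra" "p \<in> space P"
  shows "irreducible_rep (r p)"
  using measurable_space[OF measurable_section_dual[OF assms(1,2)] assms(3)]
  by (simp add: space_irreps_algebra irreps_def)

lemma section_unitary:
  assumes "measurable_section r" "sets P = sets dual_algebra" "p \<in> space P"
  shows "unitary_rep (r p)"
  using section_irreducible[OF assms] by (simp add: irreducible_rep_def)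

lemma borel_measurable_section_entry:
  fixes r :: "'g::{topological_group_add, t2_space, second_countable_topology} urep set \<Rightarrow> 'g urep"
  assumes r: "measurable_section r" and P: "sets P = sets dual_algebra"
  shows "(\<lambda>(p, y). act (r p) y (ket i) j) \<in> borel_measurable (P \<Otimes>\<^sub>M borel)"
proof (rule borel_measurable_caratheodory)
  fix y
  show "(\<lambda>p. act (r p) y (ket i) j) \<in> borel_measurable P"
    by (rule measurable_compose[OF measurable_section_dual[OF r P] borel_measurable_irreps_entry])
next
  fix p assume "p \<in> space P"
  then show "continuous_on UNIV (\<lambda>y. act (r p) y (ket i) j)"
    by (intro continuous_on_act_entry section_unitary[OF r P])
qed

lemma borel_measurable_cnj:
  "f \<in> borel_measurable M \<Longrightarrow> (\<lambda>x. cnj (f x)) \<in> borel_measurable M"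
  by (rule borel_measurable_continuous_on[OF continuous_on_cnj[OF continuous_on_id]])

text \<open>
  The entries are integrals, with parameters \<open>z\<close> and \<open>p\<close>, of a jointly measurable function.
\<close>

lemma borel_measurable_fourier_entry:
  fixes r :: "'g::{topological_group_add, t2_space, second_countable_topology} urep set \<Rightarrow> 'g urep"
  assumes r: "measurable_section r" and P: "sets P = sets dual_algebra"
    and M: "sets M = sets borel" "sigma_finite_measure M"
    and h: "(\<lambda>(z, y). h z y) \<in> borel_measurable (N \<Otimes>\<^sub>M borel)"
    and int: "\<And>z. z \<in> space N \<Longrightarrow> integrable M (h z)"
  shows "(\<lambda>(z, p). fourier M (h z) (r p) (ket j) i) \<in> borel_measurable (N \<Otimes>\<^sub>M P)"
proof -
  interpret M: sigma_finite_measure M by fact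
  have sets: "borel_measurable (N' \<Otimes>\<^sub>M M) = borel_measurable (N' \<Otimes>\<^sub>M borel)" for N' :: "'x measure"
    by (intro measurable_cong_sets sets_pair_measure_cong refl M)
  have h': "(\<lambda>(z, y). h z y) \<in> borel_measurable (N \<Otimes>\<^sub>M M)"
    unfolding sets by (rule h)
  have act': "(\<lambda>(p, y). act (r p) y (ket i) j) \<in> borel_measurable (P \<Otimes>\<^sub>M M)"
    unfolding sets by (rule borel_measurable_section_entry[OF r P])
  have "(\<lambda>w. h (fst (fst w)) (snd w)) \<in> borel_measurable ((N \<Otimes>\<^sub>M P) \<Otimes>\<^sub>M M)"
    using measurable_compose[OF _ h', of "\<lambda>w. (fst (fst w), snd w)" "(N \<Otimes>\<^sub>M P) \<Otimes>\<^sub>M M"] by simp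
  moreover have "(\<lambda>w. act (r (snd (fst w))) (snd w) (ket i) j) \<in> borel_measurable ((N \<Otimes>\<^sub>M P) \<Otimes>\<^sub>M M)"
    using measurable_compose[OF _ act', of "\<lambda>w. (snd (fst w), snd w)" "(N \<Otimes>\<^sub>M P) \<Otimes>\<^sub>M M"] by simp
  ultimately have "(\<lambda>(zp, y). h (fst zp) y * cnj (act (r (snd zp)) y (ket i) j))
      \<in> borel_measurable ((N \<Otimes>\<^sub>M P) \<Otimes>\<^sub>M M)"
    unfolding split_beta by (intro borel_measurable_times borel_measurable_cnj)
  then have "(\<lambda>zp. \<integral>y. h (fst zp) y * cnj (act (r (snd zp)) y (ket i) j) \<partial>M)
      \<in> borel_measurable (N \<Otimes>\<^sub>M P)"
    by (rule M.borel_measurable_lebesgue_integral)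
  then show ?thesis
  proof (rule measurable_cong[THEN iffD1, rotated])
    fix zp assume "zp \<in> space (N \<Otimes>\<^sub>M P)"
    then show "(\<integral>y. h (fst zp) y * cnj (act (r (snd zp)) y (ket i) j) \<partial>M) =
        (case zp of (z, p) \<Rightarrow> fourier M (h z) (r p) (ket j) i)"
      by (auto simp: space_pair_measure fourier_entry[OF section_unitary[OF r P] M(1) int])
  qed
qed

section \<open>Haar measure on a unimodular group\<close>

lemma haar_sets: "haar_measure M \<Longrightarrow> sets M = sets borel"
  by (simp add: haar_measure_def radon_measure_def)

lemma haar_space: "haar_measure M \<Longrightarrow> space M = UNIV"
  using sets_eq_imp_space_eq[OF haar_sets] by simp

lemma haar_emeasure_left:
  "haar_measure M \<Longrightarrow> A \<in> sets M \<Longrightarrow> emeasure M ((\<lambda>a. x + a) ` A) = emeasure M A"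
  by (simp add: haar_measure_def)

lemma borel_measurable_translate:
  fixes M :: "'g::{topological_group_add, t2_space, second_countable_topology} measure"
  assumes "sets M = sets borel"
  shows "(\<lambda>y. x + y) \<in> M \<rightarrow>\<^sub>M M" "(\<lambda>y. y + x) \<in> M \<rightarrow>\<^sub>M M"
  unfolding measurable_cong_sets[OF assms assms]
  by (intro borel_measurable_continuous_onI continuous_intros)+

lemma haar_nn_integral_left:
  fixes M :: "'g::{topological_group_add, t2_space, second_countable_topology} measure"
  assumes M: "haar_measure M" and g: "g \<in> borel_measurable M"
  shows "(\<integral>\<^sup>+y. g (x + y) \<partial>M) = (\<integral>\<^sup>+y. g y \<partial>M)"
proof -
  note tr = borel_measurable_translate(1)[OF haar_sets[OF M]]
  have "distr M M (\<lambda>y. x + y) = M"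
  proof (rule measure_eqI)
    fix A assume "A \<in> sets (distr M M (\<lambda>y. x + y))"
    then have A: "A \<in> sets M" by simp
    have "(\<lambda>y. x + y) -` A = (\<lambda>a. - x + a) ` A"
      by (force simp: image_iff add.assoc[symmetric])
    then show "emeasure (distr M M (\<lambda>y. x + y)) A = emeasure M A"
      using A by (simp add: emeasure_distr[OF tr] haar_space[OF M] haar_emeasure_left[OF M])
  qed simp
  then show ?thesis
    using nn_integral_distr[OF tr, of g x] g by simp
qed

lemma haar_nn_integral_right:
  fixes M :: "'g::{topological_group_add, t2_space, second_countable_topology} measure"
  assumes M: "haar_measure M" and uni: "unimodular TYPE('g)" and g: "g \<in> borel_measurable M"
  shows "(\<integral>\<^sup>+y. g (y + x) \<partial>M) = (\<integral>\<^sup>+y. g y \<partial>M)"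
proof -
  note tr = borel_measurable_translate(2)[OF haar_sets[OF M]]
  have "distr M M (\<lambda>y. y + x) = M"
  proof (rule measure_eqI)
    fix A assume "A \<in> sets (distr M M (\<lambda>y. y + x))"
    then have A: "A \<in> sets M" by simp
    have "(\<lambda>y. y + x) -` A = (\<lambda>a. a + - x) ` A"
      by (force simp: image_iff add.assoc)
    moreover have "emeasure M ((\<lambda>a. a + - x) ` A) = emeasure M A"
      by (rule uni[unfolded unimodular_def, rule_format, OF M A])
    ultimately show "emeasure (distr M M (\<lambda>y. y + x)) A = emeasure M A"
      using A by (simp add: emeasure_distr[OF tr] haar_space[OF M])
  qed simp
  then show ?thesis
    using nn_integral_distr[OF tr, of g x] g by simp
qed

lemma finite_haar_neighbourhood:
  fixes M :: "'g::{topological_group_add, t2_space} measure"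
  assumes lc: "locally_compact_space (euclidean :: 'g topology)" and M: "haar_measure M"
  obtains U where "open U" "0 \<in> U" "emeasure M U < \<infinity>"
proof -
  obtain U K where UK: "open U" "compact K" "(0::'g) \<in> U" "U \<subseteq> K"
    using lc[unfolded locally_compact_space_def, rule_format, of 0] by auto
  have "emeasure M U \<le> emeasure M K"
    using UK compact_imp_closed[OF UK(2)] by (intro emeasure_mono) (auto simp: haar_sets[OF M])
  also have "\<dots> < \<infinity>"
    using M UK(2) by (simp add: haar_measure_def radon_measure_def)
  finally show thesis
    by (rule that[OF UK(1,3)])
qed

text \<open>
  Local data about \<open>U\<close> become global through this cover: a null \<open>U\<close> would make the whole group null,
  and a \<open>U\<close> of finite measure makes \<open>M\<close> \<open>\<sigma>\<close>-finite.
\<close>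

lemma haar_translates_cover:
  fixes M :: "'g::{topological_group_add, t2_space, second_countable_topology} measure"
  assumes M: "haar_measure M" and U: "open U" "U \<noteq> {}"
  obtains W :: "nat \<Rightarrow> 'g set" where "\<And>m. W m \<in> sets M" "(\<Union>m. W m) = UNIV"
    "\<And>m. emeasure M (W m) = emeasure M U"
proof -
  obtain d :: "nat \<Rightarrow> 'g" where d: "\<And>U y. open U \<Longrightarrow> U \<noteq> {} \<Longrightarrow> \<exists>m. - d m + y \<in> U"
    by (rule dense_translates_cover) blast
  have U_sets: "U \<in> sets M"
    using U haar_sets[OF M] by simp
  have eq: "(\<lambda>a. d m + a) ` U = (\<lambda>y. - d m + y) -` U \<inter> space M" for m
    by (auto simp: image_iff add.assoc[symmetric] haar_space[OF M] intro!: bexI[of _ "- d m + _"])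
  show thesis
  proof
    show "(\<lambda>a. d m + a) ` U \<in> sets M" for m
      unfolding eq by (rule measurable_sets[OF borel_measurable_translate(1)[OF haar_sets[OF M]] U_sets])
    show "(\<Union>m. (\<lambda>a. d m + a) ` U) = UNIV"
      unfolding eq using d[OF U] by (auto simp: haar_space[OF M])
    show "emeasure M ((\<lambda>a. d m + a) ` U) = emeasure M U" for m
      by (rule haar_emeasure_left[OF M U_sets])
  qed
qed

lemma haar_open_pos:
  fixes M :: "'g::{topological_group_add, t2_space, second_countable_topology} measure"
  assumes M: "haar_measure M" and U: "open U" "U \<noteq> {}"
  shows "0 < emeasure M U"
proof (rule ccontr)
  obtain W :: "nat \<Rightarrow> 'g set" where W: "\<And>m. W m \<in> sets M" "(\<Union>m. W m) = UNIV"
      "\<And>m. emeasure M (W m) = emeasure M U"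
    by (rule haar_translates_cover[OF M U]) blast
  assume "\<not> 0 < emeasure M U"
  then have "emeasure M (\<Union>m. W m) = 0"
    using W by (intro emeasure_UN_eq_0) auto
  then show False
    using M W(2) by (simp add: haar_measure_def)
qed

lemma haar_sigma_finite:
  fixes M :: "'g::{topological_group_add, t2_space, second_countable_topology} measure"
  assumes lc: "locally_compact_space (euclidean :: 'g topology)" and M: "haar_measure M"
  shows "sigma_finite_measure M"
proof -
  obtain U where U: "open U" "(0::'g) \<in> U" "emeasure M U < \<infinity>"
    by (rule finite_haar_neighbourhood[OF lc M])
  have ne: "U \<noteq> {}" using U(2) by blast
  obtain W :: "nat \<Rightarrow> 'g set" where W: "\<And>m. W m \<in> sets M" "(\<Union>m. W m) = UNIV"
      "\<And>m. emeasure M (W m) = emeasure M U"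
    by (rule haar_translates_cover[OF M U(1) ne]) blast
  show ?thesis
  proof
    show "\<exists>A. countable A \<and> A \<subseteq> sets M \<and> \<Union>A = space M \<and> (\<forall>a\<in>A. emeasure M a \<noteq> \<infinity>)"
      using W U by (intro exI[of _ "range W"]) (auto simp: haar_space[OF M])
  qed
qed

text \<open>
  Substituting \<open>x + y\<close> for \<open>y\<close> (left invariance) moves the \<open>x\<close>-dependence from \<open>b\<close> to \<open>a\<close>; after
  exchanging the integrals, right invariance makes the inner one independent of \<open>y\<close>.  This is where
  unimodularity enters.
\<close>

lemma haar_nn_integral_translated_product:
  fixes M :: "'g::{topological_group_add, t2_space, second_countable_topology} measure"
  assumes M: "haar_measure M" "sigma_finite_measure M" and uni: "unimodular TYPE('g)"
    and a: "a \<in> borel_measurable M" and b: "b \<in> borel_measurable M"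
  shows "(\<integral>\<^sup>+x. \<integral>\<^sup>+y. a y * b (- x + y) \<partial>M \<partial>M) = (\<integral>\<^sup>+y. a y \<partial>M) * (\<integral>\<^sup>+y. b y \<partial>M)"
proof -
  interpret M: sigma_finite_measure M by fact
  interpret MM: pair_sigma_finite M M ..
  note [simp] = haar_space[OF M(1)]
  have meas2: "(\<lambda>(x, y). x + y) \<in> M \<Otimes>\<^sub>M M \<rightarrow>\<^sub>M M"
  proof -
    have "sets (M \<Otimes>\<^sub>M M) = sets (borel :: ('g \<times> 'g) measure)"
      unfolding borel_prod[symmetric] by (rule sets_pair_measure_cong[OF haar_sets[OF M(1)] haar_sets[OF M(1)]])
    then show ?thesis
      unfolding measurable_cong_sets[OF \<open>sets (M \<Otimes>\<^sub>M M) = _\<close> haar_sets[OF M(1)]] split_beta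
      by (intro borel_measurable_continuous_onI continuous_intros)
  qed
  have minus: "uminus \<in> M \<rightarrow>\<^sub>M M"
    unfolding measurable_cong_sets[OF haar_sets[OF M(1)] haar_sets[OF M(1)]]
    by (intro borel_measurable_continuous_onI continuous_intros)
  have a2: "(\<lambda>(x, y). a (x + y)) \<in> borel_measurable (M \<Otimes>\<^sub>M M)"
    using measurable_compose[OF meas2 a] by (simp add: split_beta)
  have ab: "(\<lambda>(x, y). a (x + y) * b y) \<in> borel_measurable (M \<Otimes>\<^sub>M M)"
    using a2 measurable_compose[OF measurable_snd b, of M] unfolding split_beta
    by (rule borel_measurable_times_ennreal)
  have "(\<integral>\<^sup>+y. a y * b (- x + y) \<partial>M) = (\<integral>\<^sup>+y. a (x + y) * b y \<partial>M)" for x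
  proof -
    have "(\<lambda>y. a y * b (- x + y)) \<in> borel_measurable M"
      using a measurable_compose[OF borel_measurable_translate(1)[OF haar_sets[OF M(1)]] b]
      by (rule borel_measurable_times_ennreal)
    from haar_nn_integral_left[OF M(1) this, of x] show ?thesis
      by (simp add: add.assoc[symmetric])
  qed
  then have "(\<integral>\<^sup>+x. \<integral>\<^sup>+y. a y * b (- x + y) \<partial>M \<partial>M) = (\<integral>\<^sup>+x. \<integral>\<^sup>+y. a (x + y) * b y \<partial>M \<partial>M)"
    by simp
  also have "\<dots> = (\<integral>\<^sup>+y. \<integral>\<^sup>+x. a (x + y) * b y \<partial>M \<partial>M)"
    using MM.Fubini'[OF ab] by simp
  also have "\<dots> = (\<integral>\<^sup>+y. (\<integral>\<^sup>+x. a x \<partial>M) * b y \<partial>M)"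
  proof (rule nn_integral_cong)
    fix y
    have "(\<integral>\<^sup>+x. a (x + y) * b y \<partial>M) = (\<integral>\<^sup>+x. a (x + y) \<partial>M) * b y"
      by (rule nn_integral_multc)
        (rule measurable_compose[OF borel_measurable_translate(2)[OF haar_sets[OF M(1)]] a])
    then show "(\<integral>\<^sup>+x. a (x + y) * b y \<partial>M) = (\<integral>\<^sup>+x. a x \<partial>M) * b y"
      by (simp add: haar_nn_integral_right[OF M(1) uni a])
  qed
  also have "\<dots> = (\<integral>\<^sup>+y. a y \<partial>M) * (\<integral>\<^sup>+y. b y \<partial>M)"
    by (rule nn_integral_cmult[OF b])
  finally show ?thesis .
qed

section \<open>The Plancherel measure\<close>

lemma plancherel_sets: "plancherel_measure M r P \<Longrightarrow> sets P = sets dual_algebra"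
  by (simp add: plancherel_measure_def)

lemma plancherel_fourier:
  assumes "plancherel_measure M r P" "f \<in> L1 M" "f \<in> L2 M"
  shows "(\<lambda>p. fourier M f (r p)) \<in> direct_integral P (\<lambda>p. HS (rdim (r p)))"
proof -
  have "\<forall>f\<in>L1 M \<inter> L2 M. (\<lambda>p. fourier M f (r p)) \<in> direct_integral P (\<lambda>p. HS (rdim (r p)))"
    using assms(1) unfolding plancherel_measure_def Let_def by (elim conjE)
  then show ?thesis using assms(2,3) by simp
qed

lemma borel_measurable_HS_inner_self:
  assumes "\<And>i j. (\<lambda>z. F z (ket j) i) \<in> borel_measurable N"
  shows "(\<lambda>z. HS_inner (F z) (F z)) \<in> borel_measurable N"
  unfolding HS_inner_self
  by (intro borel_measurable_suminf borel_measurable_times borel_measurable_cnj assms)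

text \<open>
  The abstract unitary \<open>U\<close> agrees almost everywhere with the Fourier transform, which transfers the
  isometry identity for \<open>U\<close> to \<open>\<integral> \<parallel>fourier f \<pi>\<parallel>\<^sup>2 d\<pi> = \<parallel>f\<parallel>\<^sup>2\<close>.
\<close>

lemma plancherel_isometry:
  assumes pl: "plancherel_measure M r P" and f: "f \<in> L1 M" "f \<in> L2 M"
  shows "(\<integral>\<^sup>+p. hs_mass (fourier M f (r p)) \<partial>P) = (\<integral>\<^sup>+x. ennreal ((cmod (f x))\<^sup>2) \<partial>M)"
proof -
  let ?D = "direct_integral P (\<lambda>p. HS (rdim (r p)))"
  let ?F = "\<lambda>p. fourier M f (r p)"
  have F: "?F \<in> ?D" by (rule plancherel_fourier[OF assms])
  obtain U where "\<forall>f\<in>L2 M. U f \<in> ?D"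
      "\<forall>f\<in>L2 M. \<forall>g\<in>L2 M. direct_integral_inner P (U f) (U g) = L2_inner M f g"
      "\<forall>f\<in>L1 M \<inter> L2 M. AE p in P. U f p = fourier M f (r p)"
    using pl unfolding plancherel_measure_def Let_def by (elim conjE exE) (rule that)
  then have U: "U f \<in> ?D" "direct_integral_inner P (U f) (U f) = L2_inner M f f"
      "AE p in P. U f p = ?F p"
    using f by simp_all
  have HS: "AE p in P. ?F p \<in> HS (rdim (r p))"
    and int: "integrable P (\<lambda>p. Re (HS_inner (?F p) (?F p)))"
    using F by (auto simp: direct_integral_def)
  have "complex_of_real (\<integral>p. Re (HS_inner (?F p) (?F p)) \<partial>P) =
      (\<integral>p. complex_of_real (Re (HS_inner (?F p) (?F p))) \<partial>P)"
    by simp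
  also have "\<dots> = (\<integral>p. HS_inner (U f p) (U f p) \<partial>P)"
  proof (rule integral_cong_AE)
    show "(\<lambda>p. HS_inner (U f p) (U f p)) \<in> borel_measurable P"
      using U(1) by (intro borel_measurable_HS_inner_self) (simp add: direct_integral_def)
    show "(\<lambda>p. complex_of_real (Re (HS_inner (?F p) (?F p)))) \<in> borel_measurable P"
      using borel_measurable_integrable[OF int] by simp
    show "AE p in P. complex_of_real (Re (HS_inner (?F p) (?F p))) = HS_inner (U f p) (U f p)"
      using U(3) HS
    proof eventually_elim
      case (elim p)
      then show ?case
        using hs_mass_eq_HS_inner(3)[OF elim(2)] by (simp add: complex_eq_iff)
    qed
  qed
  also have "\<dots> = (\<integral>x. complex_of_real ((cmod (f x))\<^sup>2) \<partial>M)"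
    using U(2) unfolding direct_integral_inner_def L2_inner_def complex_norm_square by simp
  also have "\<dots> = complex_of_real (\<integral>x. (cmod (f x))\<^sup>2 \<partial>M)"
    by (rule integral_complex_of_real)
  finally have eq: "(\<integral>p. Re (HS_inner (?F p) (?F p)) \<partial>P) = (\<integral>x. (cmod (f x))\<^sup>2 \<partial>M)"
    using of_real_eq_iff by blast
  have "(\<integral>\<^sup>+p. hs_mass (?F p) \<partial>P) = (\<integral>\<^sup>+p. ennreal (Re (HS_inner (?F p) (?F p))) \<partial>P)"
    by (rule nn_integral_cong_AE) (use HS in eventually_elim, simp add: hs_mass_eq_HS_inner)
  also have "\<dots> = ennreal (\<integral>p. Re (HS_inner (?F p) (?F p)) \<partial>P)"
    by (rule nn_integral_eq_integral[OF int]) (use HS in eventually_elim, simp add: hs_mass_eq_HS_inner)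
  also have "\<dots> = (\<integral>\<^sup>+x. ennreal ((cmod (f x))\<^sup>2) \<partial>M)"
    unfolding eq using f by (subst nn_integral_eq_integral) (auto simp: L2_def)
  finally show ?thesis .
qed

lemma indicator_L1_L2:
  assumes "V \<in> sets M" "emeasure M V < \<infinity>"
  shows "indicator V \<in> L1 M" "indicator V \<in> L2 M"
proof -
  have int: "integrable M (indicator V :: 'a \<Rightarrow> real)"
    using assms by simp
  have "(indicator V :: 'a \<Rightarrow> complex) = (\<lambda>x. complex_of_real (indicator V x))"
    by (auto simp: indicator_def)
  then show "indicator V \<in> L1 M"
    using integrable_of_real[OF int, where ?'a = complex] by (simp add: L1_def)
  have "(\<lambda>x. (cmod (indicator V x))\<^sup>2) = (indicator V :: 'a \<Rightarrow> real)"
    by (auto simp: indicator_def)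
  then show "indicator V \<in> L2 M"
    using assms(1) int by (simp add: L2_def)
qed

text \<open>
  On a small neighbourhood \<open>V\<close> of the neutral element the matrix coefficient at \<open>ket 0\<close> is close to its
  value \<open>1\<close> at the neutral element, so its integral over \<open>V\<close> has positive real part.
\<close>

lemma fourier_small_neighbourhood_nonzero:
  fixes \<pi> :: "'g::{topological_group_add, t2_space, second_countable_topology} urep"
  assumes \<pi>: "unitary_rep \<pi>" "rdim \<pi> \<noteq> 0" and M: "haar_measure M"
    and V: "open V" "0 \<in> V" "emeasure M V < \<infinity>"
    and near: "\<And>x. x \<in> V \<Longrightarrow> 1 / 2 < Re (act \<pi> x (ket 0) 0)"
  shows "fourier M (indicator V) \<pi> (ket 0) 0 \<noteq> 0"
proof -
  have V_sets: "V \<in> sets M" using V haar_sets[OF M] by simp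
  have ind: "integrable M (indicator V :: 'g \<Rightarrow> complex)"
    using indicator_L1_L2(1)[OF V_sets V(3)] by (simp add: L1_def)
  have ket: "ket 0 \<in> hilb (rdim \<pi>)"
    using \<pi>(2) by (simp add: ket_in_hilb_iff zero_enat_def[symmetric])
  let ?c = "\<lambda>x. indicator V x * cnj (act \<pi> x (ket 0) 0)"
  have "integrable M (\<lambda>x. vinner (\<lambda>i. indicator V x * adj (act \<pi> x) (ket 0) i) (ket 0))"
    using has_weak_integral_fourier[OF \<pi>(1) haar_sets[OF M] ind] ket
    by (simp add: has_weak_integral_def del: vinner_ket)
  then have int: "integrable M ?c"
    by (simp add: adj_def)
  have "0 < measure M V * (1 / 2)"
    using haar_open_pos[OF M V(1)] V(2,3) by (auto simp: measure_def enn2real_positive_iff)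
  also have "\<dots> = (\<integral>x. indicator V x * (1 / 2) \<partial>M)"
    using V_sets by simp
  also have "\<dots> \<le> (\<integral>x. Re (?c x) \<partial>M)"
  proof (rule integral_mono)
    show "integrable M (\<lambda>x. indicator V x * (1 / 2 :: real))"
      using V_sets V(3) by simp
    show "integrable M (\<lambda>x. Re (?c x))"
      using int by (rule integrable_Re)
    show "indicator V x * (1 / 2) \<le> Re (?c x)" for x
      using near[of x] by (cases "x \<in> V") auto
  qed
  also have "\<dots> = Re (fourier M (indicator V) \<pi> (ket 0) 0)"
    using integral_Re[OF int] by (simp add: fourier_entry[OF \<pi>(1) haar_sets[OF M] ind])
  finally show ?thesis by auto
qed

text \<open>
  Without \<open>\<sigma>\<close>-finiteness of \<open>P\<close> neither the product measure nor Tonelli's theorem is available, so it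
  has to be derived from the Plancherel property.  Let \<open>V k\<close> shrink to the neutral element.  The function
  \<open>c k\<close>, the squared corner entry of the Fourier transform of the indicator of \<open>V k\<close>, is integrable
  by the Plancherel property; hence the sets where it is at least \<open>1 / Suc m\<close> have finite measure.
  They cover the dual, since for each irreducible representation some \<open>c k\<close> is nonzero by the
  preceding lemma.
\<close>

lemma plancherel_sigma_finite:
  fixes M :: "'g::{topological_group_add, t2_space, second_countable_topology} measure"
  assumes lc: "locally_compact_space (euclidean :: 'g topology)" and M: "haar_measure M"
    and r: "measurable_section r" and pl: "plancherel_measure M r P"
  shows "sigma_finite_measure P"
proof -
  note P = plancherel_sets[OF pl]
  obtain U where U: "open U" "(0::'g) \<in> U" "emeasure M U < \<infinity>"
    by (rule finite_haar_neighbourhood[OF lc M])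
  obtain A :: "nat \<Rightarrow> 'g set" where A: "\<And>k. open (A k)" "\<And>k. 0 \<in> A k"
      "\<And>S. open S \<Longrightarrow> 0 \<in> S \<Longrightarrow> eventually (\<lambda>k. A k \<subseteq> S) sequentially"
    by (rule countable_basis_at_decseq[of "0 :: 'g"]) blast
  \<comment> \<open>Intersecting with \<open>U\<close> makes the indicators integrable.\<close>
  define V where "V k = A k \<inter> U" for k
  have V: "open (V k)" "0 \<in> V k" "emeasure M (V k) < \<infinity>" for k
  proof -
    show "open (V k)" "0 \<in> V k"
      using A U by (auto simp: V_def)
    have "emeasure M (V k) \<le> emeasure M U"
      using A U by (intro emeasure_mono) (auto simp: V_def haar_sets[OF M])
    also note U(3)
    finally show "emeasure M (V k) < \<infinity>" .
  qed
  define c where "c k p = (cmod (fourier M (indicator (V k)) (r p) (ket 0) 0))\<^sup>2" for k p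
  have int_c: "integrable P (c k)" for k
  proof -
    have V_sets: "V k \<in> sets M" using V haar_sets[OF M] by simp
    have F: "(\<lambda>p. fourier M (indicator (V k)) (r p)) \<in> direct_integral P (\<lambda>p. HS (rdim (r p)))"
      by (rule plancherel_fourier[OF pl indicator_L1_L2[OF V_sets V(3)]])
    show ?thesis
    proof (rule Bochner_Integration.integrable_bound)
      show "integrable P (\<lambda>p. Re (HS_inner (fourier M (indicator (V k)) (r p)) (fourier M (indicator (V k)) (r p))))"
        using F by (simp add: direct_integral_def)
      have "(\<lambda>p. fourier M (indicator (V k)) (r p) (ket 0) 0) \<in> borel_measurable P"
        using F by (simp add: direct_integral_def)
      then show "c k \<in> borel_measurable P"
        unfolding c_def[abs_def] by measurable
      have "AE p in P. fourier M (indicator (V k)) (r p) \<in> HS (rdim (r p))"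
        using F by (simp add: direct_integral_def)
      then show "AE p in P. norm (c k p) \<le>
          norm (Re (HS_inner (fourier M (indicator (V k)) (r p)) (fourier M (indicator (V k)) (r p))))"
      proof eventually_elim
        case (elim p)
        show ?case
          using norm_entry_le_HS_inner[OF elim, of 0 0] by (simp add: c_def)
      qed
    qed
  qed
  define E where "E k m = {p \<in> space P. 1 / real (Suc m) \<le> c k p}" for k m
  have E: "E k m \<in> sets P" "emeasure P (E k m) \<noteq> \<infinity>" for k m
  proof -
    show "E k m \<in> sets P"
      unfolding E_def using borel_measurable_integrable[OF int_c, of k] by measurable
    have "emeasure P (E k m) \<le> ennreal ((1 / (1 / real (Suc m))) * (\<integral>p. c k p \<partial>P))"
      unfolding E_def by (rule integral_Markov_inequality[OF int_c]) (auto simp: c_def)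
    then show "emeasure P (E k m) \<noteq> \<infinity>"
      using ennreal_less_top neq_top_trans by force
  qed
  have cover: "p \<in> (\<Union>k m. E k m)" if p: "p \<in> space P" for p
  proof -
    have irr: "irreducible_rep (r p)" by (rule section_irreducible[OF r P p])
    then have \<pi>: "unitary_rep (r p)" "rdim (r p) \<noteq> 0"
      by (auto simp: irreducible_rep_def)
    let ?S = "{x. 1 / 2 < Re (act (r p) x (ket 0) 0)}"
    have "open ?S"
      by (intro open_Collect_less continuous_intros continuous_on_act_entry[OF \<pi>(1)])
    moreover have "act (r p) 0 (ket 0) = ket 0"
      using \<pi> by (intro act_zero) (auto simp: ket_in_hilb_iff zero_enat_def[symmetric])
    then have "0 \<in> ?S"
      by (simp add: ket_def)
    ultimately have "eventually (\<lambda>k. A k \<subseteq> ?S) sequentially"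
      by (rule A(3))
    then obtain k where k: "A k \<subseteq> ?S"
      by (auto simp: eventually_sequentially)
    have "fourier M (indicator (V k)) (r p) (ket 0) 0 \<noteq> 0"
      by (rule fourier_small_neighbourhood_nonzero[OF \<pi> M V]) (use k in \<open>auto simp: V_def\<close>)
    then have "0 < c k p" by (simp add: c_def)
    then obtain m where "1 / real (Suc m) < c k p"
      using nat_approx_posE by blast
    then show ?thesis
      using p by (auto simp: E_def intro: less_imp_le)
  qed
  show ?thesis
  proof
    show "\<exists>B. countable B \<and> B \<subseteq> sets P \<and> \<Union>B = space P \<and> (\<forall>a\<in>B. emeasure P a \<noteq> \<infinity>)"
    proof (intro exI conjI)
      show "countable (\<Union>k. range (E k))" by simp
      show "(\<Union>k. range (E k)) \<subseteq> sets P" using E(1) by auto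
      show "\<Union>(\<Union>k. range (E k)) = space P"
        using cover by (auto simp: E_def)
      show "\<forall>a\<in>(\<Union>k. range (E k)). emeasure P a \<noteq> \<infinity>" using E(2) by auto
    qed
  qed
qed

section \<open>The Gabor transform\<close>

lemma Cc_L2:
  fixes M :: "'g::t2_space measure"
  assumes M: "radon_measure M" and f: "f \<in> Cc"
  shows "f \<in> L2 M" "\<exists>B. \<forall>x. cmod (f x) \<le> B"
proof -
  let ?K = "closure {x. f x \<noteq> 0}"
  have sets: "sets M = sets borel" using M by (simp add: radon_measure_def)
  have K: "compact ?K" and cont: "continuous_on UNIV f"
    using f by (auto simp: Cc_def)
  have "compact (f ` ?K)"
    using K cont by (intro compact_continuous_image continuous_on_subset[OF cont]) auto
  then obtain B where B: "\<And>x. x \<in> ?K \<Longrightarrow> cmod (f x) \<le> B"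
    using compact_imp_bounded[of "f ` ?K"] by (auto simp: bounded_iff)
  have zero: "f x = 0" if "x \<notin> ?K" for x
    using that closure_subset[of "{x. f x \<noteq> 0}"] by auto
  have bound: "cmod (f x) \<le> max B 0" for x
    using B[of x] zero[of x] by (cases "x \<in> ?K") auto
  then show "\<exists>B. \<forall>x. cmod (f x) \<le> B" by blast
  have meas: "f \<in> borel_measurable M"
    unfolding measurable_cong_sets[OF sets refl] using cont by (rule borel_measurable_continuous_onI)
  have "integrable M (\<lambda>x. (cmod (f x))\<^sup>2)"
  proof (rule Bochner_Integration.integrable_bound)
    have "\<forall>K. compact K \<longrightarrow> emeasure M K < \<infinity>"
      using M unfolding radon_measure_def by (elim conjE)
    then have "emeasure M ?K < \<infinity>"
      using K by simp
    moreover have "?K \<in> sets M"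
      by (simp add: sets)
    ultimately show "integrable M (\<lambda>x. (max B 0)\<^sup>2 * indicator ?K x)"
      by simp
    show "(\<lambda>x. (cmod (f x))\<^sup>2) \<in> borel_measurable M"
      using meas by measurable
    have "(cmod (f x))\<^sup>2 \<le> (max B 0)\<^sup>2 * indicator ?K x" for x
      using power_mono[OF bound[of x], of 2] zero[of x] by (cases "x \<in> ?K") auto
    then show "AE x in M. norm ((cmod (f x))\<^sup>2) \<le> norm ((max B 0)\<^sup>2 * indicator ?K x)"
      by (simp add: abs_mult)
  qed
  then show "f \<in> L2 M" using meas by (simp add: L2_def)
qed

lemma L2_mult_L1:
  assumes f: "f \<in> L2 M" and g: "g \<in> L2 M"
  shows "(\<lambda>x. f x * cnj (g x)) \<in> L1 M"
proof -
  have [measurable]: "f \<in> borel_measurable M" "g \<in> borel_measurable M"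
    using f g by (auto simp: L2_def)
  have "integrable M (\<lambda>x. f x * cnj (g x))"
  proof (rule Bochner_Integration.integrable_bound)
    show "integrable M (\<lambda>x. (cmod (f x))\<^sup>2 + (cmod (g x))\<^sup>2)"
      using f g by (simp add: L2_def)
    show "(\<lambda>x. f x * cnj (g x)) \<in> borel_measurable M"
      by (intro borel_measurable_times borel_measurable_cnj) measurable
    have "cmod (f x * cnj (g x)) \<le> (cmod (f x))\<^sup>2 + (cmod (g x))\<^sup>2" for x
    proof -
      have "2 * cmod (f x) * cmod (g x) \<le> (cmod (f x))\<^sup>2 + (cmod (g x))\<^sup>2"
        by (rule sum_squares_bound)
      moreover have "0 \<le> cmod (f x) * cmod (g x)" by simp
      ultimately show ?thesis unfolding norm_mult complex_mod_cnj by linarith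
    qed
    then show "AE x in M. norm (f x * cnj (g x)) \<le> norm ((cmod (f x))\<^sup>2 + (cmod (g x))\<^sup>2)"
      by simp
  qed
  then show ?thesis by (simp add: L1_def)
qed

lemma bounded_mult_L2:
  assumes f: "f \<in> borel_measurable M" "\<forall>x. cmod (f x) \<le> B" and g: "g \<in> L2 M"
  shows "(\<lambda>x. f x * cnj (g x)) \<in> L2 M"
proof -
  have [measurable]: "f \<in> borel_measurable M" "g \<in> borel_measurable M"
    using f g by (auto simp: L2_def)
  have m: "(\<lambda>x. f x * cnj (g x)) \<in> borel_measurable M"
    by (intro borel_measurable_times borel_measurable_cnj) measurable
  have "integrable M (\<lambda>x. (cmod (f x * cnj (g x)))\<^sup>2)"
  proof (rule Bochner_Integration.integrable_bound)
    show "integrable M (\<lambda>x. B\<^sup>2 * (cmod (g x))\<^sup>2)"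
      using g by (simp add: L2_def)
    show "(\<lambda>x. (cmod (f x * cnj (g x)))\<^sup>2) \<in> borel_measurable M"
      using m by measurable
    have "(cmod (f x * cnj (g x)))\<^sup>2 \<le> B\<^sup>2 * (cmod (g x))\<^sup>2" for x
      using f(2) by (simp add: norm_mult power_mult_distrib mult_right_mono power_mono)
    then show "AE x in M. norm ((cmod (f x * cnj (g x)))\<^sup>2) \<le> norm (B\<^sup>2 * (cmod (g x))\<^sup>2)"
      by (simp add: abs_mult)
  qed
  then show ?thesis using m by (simp add: L2_def)
qed

lemma L2_translate:
  fixes M :: "'g::{topological_group_add, t2_space, second_countable_topology} measure"
  assumes M: "haar_measure M" and g: "g \<in> L2 M"
  shows "(\<lambda>y. g (x + y)) \<in> L2 M"
proof -
  have gm: "g \<in> borel_measurable M" and int: "integrable M (\<lambda>y. (cmod (g y))\<^sup>2)"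
    using g by (auto simp: L2_def)
  have m: "(\<lambda>y. g (x + y)) \<in> borel_measurable M"
    by (rule measurable_compose[OF borel_measurable_translate(1)[OF haar_sets[OF M]] gm])
  have "integrable M (\<lambda>y. (cmod (g (x + y)))\<^sup>2)"
  proof (rule integrableI_bounded)
    show "(\<lambda>y. (cmod (g (x + y)))\<^sup>2) \<in> borel_measurable M" using m by measurable
    have "(\<integral>\<^sup>+y. ennreal (norm ((cmod (g (x + y)))\<^sup>2)) \<partial>M) = (\<integral>\<^sup>+y. ennreal (norm ((cmod (g y))\<^sup>2)) \<partial>M)"
      by (rule haar_nn_integral_left[OF M, of "\<lambda>y. ennreal (norm ((cmod (g y))\<^sup>2))"])
        (use gm in measurable)
    also have "\<dots> < \<infinity>"
      using int by (simp add: integrable_iff_bounded)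
    finally show "(\<integral>\<^sup>+y. ennreal (norm ((cmod (g (x + y)))\<^sup>2)) \<partial>M) < \<infinity>" .
  qed
  then show ?thesis using m by (simp add: L2_def)
qed

text \<open>
  As \<open>act \<pi> x\<close> is unitary, multiplication by it maps the Hilbert--Schmidt operators onto themselves:
  \<open>F = \<pi>(x) (\<pi>(- x) F)\<close>.
\<close>

lemma HS_in_gabor_fibre:
  fixes \<pi> :: "'g::topological_group_add urep"
  assumes \<pi>: "unitary_rep \<pi>" and F: "F \<in> HS (rdim \<pi>)"
  shows "F \<in> gabor_fibre \<pi> x"
proof -
  let ?n = "rdim \<pi>"
  let ?T = "act \<pi> (- x) \<circ> F"
  have Fb: "F \<in> bounded_ops ?n ?n" and Fs: "summable (\<lambda>i. (vnorm (F (ket i)))\<^sup>2)"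
    using F by (auto simp: HS_def)
  note FH = bounded_ops_in_hilb[OF Fb]
  note actb = act_bounded_ops[OF \<pi>, of "- x"]
  have "?T \<in> bounded_ops ?n ?n"
  proof -
    have "?T (lincomb a u b v) = lincomb a (?T u) b (?T v)" if uv: "u \<in> hilb ?n" "v \<in> hilb ?n" for a b u v
    proof -
      have "F (lincomb a u b v) = lincomb a (F u) b (F v)"
        using Fb uv by (simp add: bounded_ops_def)
      moreover have "act \<pi> (- x) (lincomb a (F u) b (F v)) =
          lincomb a (act \<pi> (- x) (F u)) b (act \<pi> (- x) (F v))"
        using actb FH by (simp add: bounded_ops_def)
      ultimately show ?thesis by simp
    qed
    moreover have "?T v = vzero" if "v \<notin> hilb ?n" for v
      using Fb that bounded_ops_vzero[OF actb] by (simp add: bounded_ops_def)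
    moreover obtain C where "\<forall>v\<in>hilb ?n. vnorm (F v) \<le> C * vnorm v"
      using Fb by (auto simp: bounded_ops_def)
    then have "\<forall>v\<in>hilb ?n. vnorm (?T v) \<le> C * vnorm v"
      by (simp add: vnorm_act[OF \<pi> FH])
    then have "\<exists>C. \<forall>v\<in>hilb ?n. vnorm (?T v) \<le> C * vnorm v" ..
    moreover have "\<forall>v\<in>hilb ?n. ?T v \<in> hilb ?n"
      by (simp add: act_in_hilb[OF \<pi>])
    ultimately show ?thesis
      unfolding bounded_ops_def by blast
  qed
  then have "?T \<in> HS ?n"
    using Fs by (simp add: HS_def vnorm_act[OF \<pi> FH])
  moreover have "F = act \<pi> x \<circ> ?T"
  proof
    fix v
    show "F v = (act \<pi> x \<circ> ?T) v"
      using act_add[OF \<pi>, of x "- x" "F v"] act_zero[OF \<pi> FH, of v] by simp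
  qed
  ultimately show ?thesis
    unfolding gabor_fibre_def by blast
qed

theorem theorem3p3:
  fixes \<mu> :: "'g::{topological_group_add, t2_space, second_countable_topology} measure"
    and r :: "'g urep set \<Rightarrow> 'g urep"
    and P :: "'g urep set measure"
    and \<psi> f :: "'g \<Rightarrow> complex"
  assumes locally_compact: "locally_compact_space (euclidean :: 'g topology)"
    and non_abelian: "\<exists>x y :: 'g. x + y \<noteq> y + x"
    and unimodular: "unimodular TYPE('g)"
    and type_I: "type_I TYPE('g)"
    and haar: "haar_measure \<mu>"
    and representatives: "measurable_section r"
    and plancherel: "plancherel_measure \<mu> r P"
    and window: "\<psi> \<in> L2 \<mu>" "\<not> (AE x in \<mu>. \<psi> x = 0)"
    and f: "f \<in> Cc"
  shows "gabor \<mu> r \<psi> f \<in> H2_space \<mu> r P \<and>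
         H2_norm \<mu> P (gabor \<mu> r \<psi> f) = L2_norm \<mu> f * L2_norm \<mu> \<psi>"
proof -
  note P = plancherel_sets[OF plancherel]
  note sets = haar_sets[OF haar]
  note \<mu>_fin = haar_sigma_finite[OF locally_compact haar]
  interpret \<mu>: sigma_finite_measure \<mu> by (rule \<mu>_fin)
  interpret P: sigma_finite_measure P
    by (rule plancherel_sigma_finite[OF locally_compact haar representatives plancherel])
  let ?F = "gabor \<mu> r \<psi> f"
  define h where "h x y = f y * cnj (\<psi> (- x + y))" for x y
  have F_eq: "?F (x, p) = fourier \<mu> (h x) (r p)" for x p
    by (simp add: gabor_def fourier_def h_def)
  have radon: "radon_measure \<mu>" using haar by (simp add: haar_measure_def)
  have f2: "f \<in> L2 \<mu>" by (rule Cc_L2(1)[OF radon f])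
  have fm: "f \<in> borel_measurable \<mu>" and \<psi>m: "\<psi> \<in> borel_measurable \<mu>"
    using f2 window(1) by (auto simp: L2_def)
  obtain B where B: "\<forall>x. cmod (f x) \<le> B" using Cc_L2(2)[OF radon f] by blast
  have h1: "h x \<in> L1 \<mu>" and h2: "h x \<in> L2 \<mu>" for x
    unfolding h_def[abs_def]
    by (rule L2_mult_L1[OF f2 L2_translate[OF haar window(1)]])
      (rule bounded_mult_L2[OF fm B L2_translate[OF haar window(1)]])
  have h_int: "integrable \<mu> (h x)" for x using h1 by (simp add: L1_def)
  have h_meas: "(\<lambda>(x, y). h x y) \<in> borel_measurable (\<mu> \<Otimes>\<^sub>M borel)"
  proof -
    have s: "sets (\<mu> \<Otimes>\<^sub>M borel) = sets (borel :: ('g \<times> 'g) measure)"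
      unfolding borel_prod[symmetric] by (rule sets_pair_measure_cong[OF sets refl])
    have "(\<lambda>z. - fst z + snd z) \<in> \<mu> \<Otimes>\<^sub>M borel \<rightarrow>\<^sub>M \<mu>"
      unfolding measurable_cong_sets[OF s sets]
      by (intro borel_measurable_continuous_onI continuous_intros)
    moreover have "f \<in> borel_measurable borel"
      using fm unfolding measurable_cong_sets[OF sets refl] .
    ultimately show ?thesis
      unfolding h_def split_beta
      by (intro borel_measurable_times borel_measurable_cnj
          measurable_compose[OF measurable_snd] measurable_compose[OF _ \<psi>m])
  qed
  have entries: "(\<lambda>z. ?F z (ket j) i) \<in> borel_measurable (\<mu> \<Otimes>\<^sub>M P)" for i j
    using borel_measurable_fourier_entry[OF representatives P sets \<mu>_fin h_meas h_int, of j i]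
    by (simp add: split_beta' flip: F_eq)
  have mass_meas: "(\<lambda>z. hs_mass (?F z)) \<in> borel_measurable (\<mu> \<Otimes>\<^sub>M P)"
    unfolding hs_mass_def using entries by measurable
  define I where "I = (\<integral>y. (cmod (f y))\<^sup>2 \<partial>\<mu>) * (\<integral>y. (cmod (\<psi> y))\<^sup>2 \<partial>\<mu>)"
  have I: "0 \<le> I" by (simp add: I_def)
  have mass: "(\<integral>\<^sup>+z. hs_mass (?F z) \<partial>(\<mu> \<Otimes>\<^sub>M P)) = ennreal I"
  proof -
    have "(\<integral>\<^sup>+z. hs_mass (?F z) \<partial>(\<mu> \<Otimes>\<^sub>M P)) = (\<integral>\<^sup>+x. \<integral>\<^sup>+p. hs_mass (?F (x, p)) \<partial>P \<partial>\<mu>)"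
      by (rule P.nn_integral_fst[OF mass_meas, symmetric])
    also have "\<dots> = (\<integral>\<^sup>+x. \<integral>\<^sup>+y. ennreal ((cmod (h x y))\<^sup>2) \<partial>\<mu> \<partial>\<mu>)"
      unfolding F_eq by (intro nn_integral_cong plancherel_isometry[OF plancherel h1 h2])
    also have "\<dots> = (\<integral>\<^sup>+x. \<integral>\<^sup>+y. ennreal ((cmod (f y))\<^sup>2) * ennreal ((cmod (\<psi> (- x + y)))\<^sup>2) \<partial>\<mu> \<partial>\<mu>)"
      by (simp add: h_def norm_mult power_mult_distrib ennreal_mult)
    also have "\<dots> = (\<integral>\<^sup>+y. ennreal ((cmod (f y))\<^sup>2) \<partial>\<mu>) * (\<integral>\<^sup>+y. ennreal ((cmod (\<psi> y))\<^sup>2) \<partial>\<mu>)"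
      by (rule haar_nn_integral_translated_product[OF haar \<mu>_fin unimodular]) (use fm \<psi>m in measurable)
    also have "\<dots> = ennreal I"
      using f2 window(1) by (simp add: I_def L2_def nn_integral_eq_integral ennreal_mult)
    finally show ?thesis .
  qed
  have space_P: "p \<in> space P" if "(x, p) \<in> space (\<mu> \<Otimes>\<^sub>M P)" for x p
    using that by (simp add: space_pair_measure)
  have "AE z in \<mu> \<Otimes>\<^sub>M P. hs_mass (?F z) \<noteq> \<infinity>"
    by (rule nn_integral_PInf_AE[OF mass_meas]) (simp add: mass)
  \<comment> \<open>Finite mass is all that the bounded operator \<open>gabor \<mu> r \<psi> f z\<close> lacks to be Hilbert--Schmidt.\<close>
  then have HS: "AE z in \<mu> \<Otimes>\<^sub>M P. ?F z \<in> HS (rdim (r (snd z)))"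
  proof (rule AE_mp, intro AE_I2 impI)
    fix z assume z: "z \<in> space (\<mu> \<Otimes>\<^sub>M P)" and fin: "hs_mass (?F z) \<noteq> \<infinity>"
    obtain x p where [simp]: "z = (x, p)" by (cases z)
    have "?F z \<in> bounded_ops (rdim (r p)) (rdim (r p))"
      using fourier_bounded_ops[OF section_unitary[OF representatives P space_P] sets h_int] z
      by (simp add: F_eq)
    then show "?F z \<in> HS (rdim (r (snd z)))"
      using fin by (simp add: HS_iff_hs_mass_finite less_top)
  qed
  have fibre: "AE z in \<mu> \<Otimes>\<^sub>M P. ?F z \<in> (case z of (x, p) \<Rightarrow> gabor_fibre (r p) x)"
    using HS
  proof (rule AE_mp, intro AE_I2 impI)
    fix z assume z: "z \<in> space (\<mu> \<Otimes>\<^sub>M P)" and "?F z \<in> HS (rdim (r (snd z)))"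
    then show "?F z \<in> (case z of (x, p) \<Rightarrow> gabor_fibre (r p) x)"
      using HS_in_gabor_fibre[OF section_unitary[OF representatives P space_P]] by (cases z) simp
  qed
  have bochner: "has_bochner_integral (\<mu> \<Otimes>\<^sub>M P) (\<lambda>z. Re (HS_inner (?F z) (?F z))) I"
  proof (rule has_bochner_integral_nn_integral[OF _ _ I])
    show "(\<lambda>z. Re (HS_inner (?F z) (?F z))) \<in> borel_measurable (\<mu> \<Otimes>\<^sub>M P)"
      using borel_measurable_HS_inner_self[of ?F, OF entries] by measurable
    show "AE z in \<mu> \<Otimes>\<^sub>M P. 0 \<le> Re (HS_inner (?F z) (?F z))"
      using HS by eventually_elim (rule hs_mass_eq_HS_inner)
    have "(\<integral>\<^sup>+z. ennreal (Re (HS_inner (?F z) (?F z))) \<partial>(\<mu> \<Otimes>\<^sub>M P)) = (\<integral>\<^sup>+z. hs_mass (?F z) \<partial>(\<mu> \<Otimes>\<^sub>M P))"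
      by (rule nn_integral_cong_AE) (use HS in eventually_elim, simp add: hs_mass_eq_HS_inner)
    then show "(\<integral>\<^sup>+z. ennreal (Re (HS_inner (?F z) (?F z))) \<partial>(\<mu> \<Otimes>\<^sub>M P)) = ennreal I"
      by (simp add: mass)
  qed
  have "?F \<in> H2_space \<mu> r P"
    unfolding H2_space_def direct_integral_def
    using entries fibre bochner by (auto simp: has_bochner_integral_iff)
  moreover have "H2_norm \<mu> P ?F = sqrt I"
    using bochner by (simp add: H2_norm_def direct_integral_norm_def has_bochner_integral_iff)
  moreover have "sqrt I = L2_norm \<mu> f * L2_norm \<mu> \<psi>"
    by (simp add: I_def L2_norm_def real_sqrt_mult)
  ultimately show ?thesis by simp
qed

end
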